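(* Let $\mathcal{C}$ be an a.s.-compatibly representable Markov category with conditionals and let $p$ be a hidden Markov model in $\mathcal{C}$ with transition kernels $f_t\colon X_{t-1}\to X_t$ and observation kernels $g_t\colon X_t\to Y_t$, $t=0,\dots,n$. Then for all $t=0,\dots,n$ the deterministic counterpart of the Bayes filter is $$\mathrm{BF}_t^\sharp\;=_{p^Y_{[t]}\text{-a.s.}}\;u_t^\sharp\circ(u_{t-1}^\sharp\otimes\mathrm{id}_{Y_t})\circ(u_{t-2}^\sharp\otimes\mathrm{id}_{Y_{t-1}\otimes Y_t})\circ\cdots\circ(u_0^\sharp\otimes\mathrm{id}_{Y_1\otimes\cdots\otimes Y_t}),$$ and composing the right-hand side with $\mathsf{samp}_{X_t}$ recovers $\mathrm{BF}_t$ itself (up to $p^Y_{[t]}$-a.s. equality).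
   Context: A Markov category is a symmetric monoidal category whose monoidal unit $I$ is terminal, in which every object $X$ carries a distinguished commutative comonoid structure $\mathrm{copy}_X\colon X\to X\otimes X$, $\mathrm{del}_X\colon X\to I$, compatible with $\otimes$. Coherence isomorphisms and symmetries are suppressed. A morphism $f\colon A\to X$ is deterministic if $\mathrm{copy}_X\circ f=(f\otimes f)\circ\mathrm{copy}_A$. Conditionals: a conditional of $f\colon A\to X\otimes Y$ with respect to $Y$ is a morphism $f_{|Y}\colon A\otimes Y\to X$ such that $f$ equals the composite: copy $A$; apply to one copy the marginal $f_Y:=(\mathrm{del}_X\otimes\mathrm{id}_Y)\circ f$; copy the resulting $Y$; output one copy of $Y$ and apply $f_{|Y}$ to the other copy of $A$ and the other copy of $Y$ to produce $X$. $\mathcal{C}$ has conditionals if these always exist. Almost sure equality: for $q\colon W\to A$ and $a,b\colon A\to X$, $a=_{q\text{-a.s.}}b$ means $(\mathrm{id}_A\otimes a)\circ\mathrm{copy}_A\circ q=(\mathrm{id}_A\otimes b)\circ\mathrm{copy}_A\circ q$. Representability: $\mathcal{C}$ is representable if for every object $X$ there are an object $PX$ and a morphism $\mathsf{samp}_X\colon PX\to X$ such that every $f\colon A\to X$ factors as $f=\mathsf{samp}_X\circ f^\sharp$ for a unique deterministic $f^\sharp\colon A\to PX$ (the deterministic counterpart). It is a.s.-compatibly representable if moreover $a=_{q\text{-a.s.}}b$ implies $a^\sharp=_{q\text{-a.s.}}b^\sharp$ for all $q\colon W\to A$ and $a,b\colon A\to X$. Notation: $[t]=\{0,\dots,t\}$;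 $Y_{[t]}=Y_0\otimes\cdots\otimes Y_t$; conventions $X_{-1}=I$, $PX_{-1}=I$, $\mathrm{BF}_{-1}=\mathrm{id}_I$. Hidden Markov model: given $f_t\colon X_{t-1}\to X_t$ and $g_t\colon X_t\to Y_t$ ($t=0,\dots,n$), it is the state $p\colon I\to\bigotimes_{t\in[n]}(X_t\otimes Y_t)$, $p=\big(\bigotimes_{t=0}^n((\mathrm{id}_{X_t}\otimes g_t)\circ\mathrm{copy}_{X_t})\big)\circ m_n$, where $m_0=f_0$ and $m_t=\big(\mathrm{id}_{X_0\otimes\cdots\otimes X_{t-2}}\otimes((\mathrm{id}_{X_{t-1}}\otimes f_t)\circ\mathrm{copy}_{X_{t-1}})\big)\circ m_{t-1}$. Write $p^Y_{[t]}$ for the marginal of $p$ on $Y_{[t]}$. Bayes filter: $\mathrm{BF}_t\colon Y_{[t]}\to X_t$ is a (choice of) conditional, with respect to $Y_{[t]}$, of the marginal of $p$ on $Y_{[t]}\otimes X_t$; it is unique up to $p^Y_{[t]}$-a.s. equality. Update maps: $u_t\colon PX_{t-1}\otimes Y_t\to X_t$ is a (choice of) conditional with respect to $Y_t$ of $(\mathrm{id}_{X_t}\otimes g_t)\circ\mathrm{copy}_{X_t}\circ f_t\circ\mathsf{samp}_{X_{t-1}}\colon PX_{t-1}\to X_t\otimes Y_t$ (with $u_0=\mathrm{BF}_0$), and $u_t^\sharp\colon PX_{t-1}\otimes Y_t\to PX_t$ is its deterministic counterpart. *)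

theory Defs
  imports Main
begin

section \<open>Markov categories\<close>

text \<open>
  Monoidal structure is not assumed strict: the associators \<open>\<alpha>\<close>, unitors \<open>\<ell>\<close>, \<open>\<rho>\<close> and the
  symmetry \<open>\<sigma>\<close> are part of the data, and they are written out wherever the informal notation
  suppresses them.
\<close>

record ('o, 'm) markov_data =
  Obj :: "'o set"
  Arr :: "'m set"
  Dom :: "'m \<Rightarrow> 'o"
  Cod :: "'m \<Rightarrow> 'o"
  ident :: "'o \<Rightarrow> 'm"  ("\<one>\<index>")
  comp :: "'m \<Rightarrow> 'm \<Rightarrow> 'm"  (infixr "\<cdot>\<index>" 60)
  tensor_obj :: "'o \<Rightarrow> 'o \<Rightarrow> 'o"  (infixl "\<odot>\<index>" 75)
  tensor :: "'m \<Rightarrow> 'm \<Rightarrow> 'm"  (infixl "\<otimes>\<index>" 70)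
  unit_obj :: "'o"  ("\<I>\<index>")
  assoc :: "'o \<Rightarrow> 'o \<Rightarrow> 'o \<Rightarrow> 'm"  ("\<alpha>\<index>")
  assoc_inv :: "'o \<Rightarrow> 'o \<Rightarrow> 'o \<Rightarrow> 'm"  ("\<alpha>'_inv\<index>")
  lunit :: "'o \<Rightarrow> 'm"  ("\<ell>\<index>")
  lunit_inv :: "'o \<Rightarrow> 'm"  ("\<ell>'_inv\<index>")
  runit :: "'o \<Rightarrow> 'm"  ("\<rho>\<index>")
  runit_inv :: "'o \<Rightarrow> 'm"  ("\<rho>'_inv\<index>")
  swap :: "'o \<Rightarrow> 'o \<Rightarrow> 'm"  ("\<sigma>\<index>")
  copy :: "'o \<Rightarrow> 'm"  ("\<Delta>\<index>")
  del :: "'o \<Rightarrow> 'm"  ("\<epsilon>\<index>")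

definition in_hom ::
  "('o, 'm, 'z) markov_data_scheme \<Rightarrow> 'm \<Rightarrow> 'o \<Rightarrow> 'o \<Rightarrow> bool"
  ("\<guillemotleft>_ : _ \<rightarrow>\<index> _\<guillemotright>")
  where "\<guillemotleft>f : A \<rightarrow> B\<guillemotright> \<longleftrightarrow> f \<in> Arr C \<and> Dom C f = A \<and> Cod C f = B"
  for C (structure)

locale category =
  fixes C :: "('o, 'm, 'z) markov_data_scheme" (structure)
  assumes dom_obj: "f \<in> Arr C \<Longrightarrow> Dom C f \<in> Obj C"
    and cod_obj: "f \<in> Arr C \<Longrightarrow> Cod C f \<in> Obj C"
    and ident_hom: "A \<in> Obj C \<Longrightarrow> \<guillemotleft>\<one> A : A \<rightarrow> A\<guillemotright>"
    and comp_hom: "\<lbrakk>\<guillemotleft>f : A \<rightarrow> B\<guillemotright>; \<guillemotleft>g : B \<rightarrow> D\<guillemotright>\<rbrakk> \<Longrightarrow> \<guillemotleft>g \<cdot> f : A \<rightarrow> D\<guillemotright>"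
    and comp_ident_right: "\<guillemotleft>f : A \<rightarrow> B\<guillemotright> \<Longrightarrow> f \<cdot> \<one> A = f"
    and comp_ident_left: "\<guillemotleft>f : A \<rightarrow> B\<guillemotright> \<Longrightarrow> \<one> B \<cdot> f = f"
    and comp_assoc:
      "\<lbrakk>\<guillemotleft>f : A \<rightarrow> B\<guillemotright>; \<guillemotleft>g : B \<rightarrow> D\<guillemotright>; \<guillemotleft>h : D \<rightarrow> E\<guillemotright>\<rbrakk> \<Longrightarrow> (h \<cdot> g) \<cdot> f = h \<cdot> g \<cdot> f"

locale monoidal_category = category +
  assumes unit_obj: "\<I> \<in> Obj C"
    and tensor_obj: "\<lbrakk>A \<in> Obj C; B \<in> Obj C\<rbrakk> \<Longrightarrow> A \<odot> B \<in> Obj C"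
    and tensor_hom: "\<lbrakk>\<guillemotleft>f : A \<rightarrow> B\<guillemotright>; \<guillemotleft>g : D \<rightarrow> E\<guillemotright>\<rbrakk> \<Longrightarrow> \<guillemotleft>f \<otimes> g : A \<odot> D \<rightarrow> B \<odot> E\<guillemotright>"
    and tensor_ident: "\<lbrakk>A \<in> Obj C; B \<in> Obj C\<rbrakk> \<Longrightarrow> \<one> A \<otimes> \<one> B = \<one> (A \<odot> B)"
    and tensor_comp:
      "\<lbrakk>\<guillemotleft>f : A \<rightarrow> B\<guillemotright>; \<guillemotleft>g : B \<rightarrow> D\<guillemotright>; \<guillemotleft>f' : A' \<rightarrow> B'\<guillemotright>; \<guillemotleft>g' : B' \<rightarrow> D'\<guillemotright>\<rbrakk>
        \<Longrightarrow> (g \<cdot> f) \<otimes> (g' \<cdot> f') = (g \<otimes> g') \<cdot> (f \<otimes> f')"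
    and assoc_hom:
      "\<lbrakk>A \<in> Obj C; B \<in> Obj C; D \<in> Obj C\<rbrakk> \<Longrightarrow> \<guillemotleft>\<alpha> A B D : (A \<odot> B) \<odot> D \<rightarrow> A \<odot> (B \<odot> D)\<guillemotright>"
    and assoc_inv_hom:
      "\<lbrakk>A \<in> Obj C; B \<in> Obj C; D \<in> Obj C\<rbrakk> \<Longrightarrow> \<guillemotleft>\<alpha>_inv A B D : A \<odot> (B \<odot> D) \<rightarrow> (A \<odot> B) \<odot> D\<guillemotright>"
    and assoc_inv_left:
      "\<lbrakk>A \<in> Obj C; B \<in> Obj C; D \<in> Obj C\<rbrakk> \<Longrightarrow> \<alpha>_inv A B D \<cdot> \<alpha> A B D = \<one> ((A \<odot> B) \<odot> D)"
    and assoc_inv_right: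
      "\<lbrakk>A \<in> Obj C; B \<in> Obj C; D \<in> Obj C\<rbrakk> \<Longrightarrow> \<alpha> A B D \<cdot> \<alpha>_inv A B D = \<one> (A \<odot> (B \<odot> D))"
    and assoc_natural:
      "\<lbrakk>\<guillemotleft>f : A \<rightarrow> A'\<guillemotright>; \<guillemotleft>g : B \<rightarrow> B'\<guillemotright>; \<guillemotleft>h : D \<rightarrow> D'\<guillemotright>\<rbrakk>
        \<Longrightarrow> \<alpha> A' B' D' \<cdot> ((f \<otimes> g) \<otimes> h) = (f \<otimes> (g \<otimes> h)) \<cdot> \<alpha> A B D"
    and lunit_hom: "A \<in> Obj C \<Longrightarrow> \<guillemotleft>\<ell> A : \<I> \<odot> A \<rightarrow> A\<guillemotright>"
    and lunit_inv_hom: "A \<in> Obj C \<Longrightarrow> \<guillemotleft>\<ell>_inv A : A \<rightarrow> \<I> \<odot> A\<guillemotright>"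
    and lunit_inv_left: "A \<in> Obj C \<Longrightarrow> \<ell>_inv A \<cdot> \<ell> A = \<one> (\<I> \<odot> A)"
    and lunit_inv_right: "A \<in> Obj C \<Longrightarrow> \<ell> A \<cdot> \<ell>_inv A = \<one> A"
    and lunit_natural: "\<guillemotleft>f : A \<rightarrow> B\<guillemotright> \<Longrightarrow> \<ell> B \<cdot> (\<one> \<I> \<otimes> f) = f \<cdot> \<ell> A"
    and runit_hom: "A \<in> Obj C \<Longrightarrow> \<guillemotleft>\<rho> A : A \<odot> \<I> \<rightarrow> A\<guillemotright>"
    and runit_inv_hom: "A \<in> Obj C \<Longrightarrow> \<guillemotleft>\<rho>_inv A : A \<rightarrow> A \<odot> \<I>\<guillemotright>"
    and runit_inv_left: "A \<in> Obj C \<Longrightarrow> \<rho>_inv A \<cdot> \<rho> A = \<one> (A \<odot> \<I>)"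
    and runit_inv_right: "A \<in> Obj C \<Longrightarrow> \<rho> A \<cdot> \<rho>_inv A = \<one> A"
    and runit_natural: "\<guillemotleft>f : A \<rightarrow> B\<guillemotright> \<Longrightarrow> \<rho> B \<cdot> (f \<otimes> \<one> \<I>) = f \<cdot> \<rho> A"
    and pentagon:
      "\<lbrakk>A \<in> Obj C; B \<in> Obj C; D \<in> Obj C; E \<in> Obj C\<rbrakk>
        \<Longrightarrow> (\<one> A \<otimes> \<alpha> B D E) \<cdot> \<alpha> A (B \<odot> D) E \<cdot> (\<alpha> A B D \<otimes> \<one> E)
            = \<alpha> A B (D \<odot> E) \<cdot> \<alpha> (A \<odot> B) D E"
    and triangle:
      "\<lbrakk>A \<in> Obj C; B \<in> Obj C\<rbrakk> \<Longrightarrow> (\<one> A \<otimes> \<ell> B) \<cdot> \<alpha> A \<I> B = \<rho> A \<otimes> \<one> B"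

locale symmetric_monoidal_category = monoidal_category +
  assumes swap_hom: "\<lbrakk>A \<in> Obj C; B \<in> Obj C\<rbrakk> \<Longrightarrow> \<guillemotleft>\<sigma> A B : A \<odot> B \<rightarrow> B \<odot> A\<guillemotright>"
    and swap_natural:
      "\<lbrakk>\<guillemotleft>f : A \<rightarrow> A'\<guillemotright>; \<guillemotleft>g : B \<rightarrow> B'\<guillemotright>\<rbrakk> \<Longrightarrow> \<sigma> A' B' \<cdot> (f \<otimes> g) = (g \<otimes> f) \<cdot> \<sigma> A B"
    and swap_swap: "\<lbrakk>A \<in> Obj C; B \<in> Obj C\<rbrakk> \<Longrightarrow> \<sigma> B A \<cdot> \<sigma> A B = \<one> (A \<odot> B)"
    and hexagon:
      "\<lbrakk>A \<in> Obj C; B \<in> Obj C; D \<in> Obj C\<rbrakk>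
        \<Longrightarrow> \<alpha> B D A \<cdot> \<sigma> A (B \<odot> D) \<cdot> \<alpha> A B D
            = (\<one> B \<otimes> \<sigma> A D) \<cdot> \<alpha> B A D \<cdot> (\<sigma> A B \<otimes> \<one> D)"

text \<open>The coherence isomorphism \<open>(A \<odot> B) \<odot> (D \<odot> E) \<rightarrow> (A \<odot> D) \<odot> (B \<odot> E)\<close>.\<close>

definition middle_swap ::
  "('o, 'm, 'z) markov_data_scheme \<Rightarrow> 'o \<Rightarrow> 'o \<Rightarrow> 'o \<Rightarrow> 'o \<Rightarrow> 'm"
  where "middle_swap C A B D E =
    \<alpha>_inv A D (B \<odot> E) \<cdot> (\<one> A \<otimes> \<alpha> D B E) \<cdot> (\<one> A \<otimes> (\<sigma> B D \<otimes> \<one> E))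
      \<cdot> (\<one> A \<otimes> \<alpha>_inv B D E) \<cdot> \<alpha> A B (D \<odot> E)"
  for C (structure)

text \<open>
  The remaining compatibilities of copying and deletion with the monoidal structure, namely those
  for \<open>del\<close> and for \<open>copy\<close> on the unit object, follow from terminality and counitality.
\<close>

locale markov_category = symmetric_monoidal_category +
  assumes copy_hom: "X \<in> Obj C \<Longrightarrow> \<guillemotleft>\<Delta> X : X \<rightarrow> X \<odot> X\<guillemotright>"
    and del_hom: "X \<in> Obj C \<Longrightarrow> \<guillemotleft>\<epsilon> X : X \<rightarrow> \<I>\<guillemotright>"
    and unit_terminal: "\<guillemotleft>f : X \<rightarrow> \<I>\<guillemotright> \<Longrightarrow> f = \<epsilon> X"
    and copy_assoc:
      "X \<in> Obj C \<Longrightarrow> \<alpha> X X X \<cdot> (\<Delta> X \<otimes> \<one> X) \<cdot> \<Delta> X = (\<one> X \<otimes> \<Delta> X) \<cdot> \<Delta> X"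
    and copy_counit_left: "X \<in> Obj C \<Longrightarrow> \<ell> X \<cdot> (\<epsilon> X \<otimes> \<one> X) \<cdot> \<Delta> X = \<one> X"
    and copy_counit_right: "X \<in> Obj C \<Longrightarrow> \<rho> X \<cdot> (\<one> X \<otimes> \<epsilon> X) \<cdot> \<Delta> X = \<one> X"
    and copy_comm: "X \<in> Obj C \<Longrightarrow> \<sigma> X X \<cdot> \<Delta> X = \<Delta> X"
    and copy_tensor:
      "\<lbrakk>X \<in> Obj C; Y \<in> Obj C\<rbrakk> \<Longrightarrow> \<Delta> (X \<odot> Y) = middle_swap C X X Y Y \<cdot> (\<Delta> X \<otimes> \<Delta> Y)"


section \<open>Determinism, marginals, conditionals, almost sure equality\<close>

definition deterministic :: "('o, 'm, 'z) markov_data_scheme \<Rightarrow> 'm \<Rightarrow> bool"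
  where "deterministic C f \<longleftrightarrow>
    f \<in> Arr C \<and> \<Delta> (Cod C f) \<cdot> f = (f \<otimes> f) \<cdot> \<Delta> (Dom C f)"
  for C (structure)

definition proj_left :: "('o, 'm, 'z) markov_data_scheme \<Rightarrow> 'o \<Rightarrow> 'o \<Rightarrow> 'm"
  where "proj_left C X Y = \<rho> X \<cdot> (\<one> X \<otimes> \<epsilon> Y)"
  for C (structure)

definition proj_right :: "('o, 'm, 'z) markov_data_scheme \<Rightarrow> 'o \<Rightarrow> 'o \<Rightarrow> 'm"
  where "proj_right C X Y = \<ell> Y \<cdot> (\<epsilon> X \<otimes> \<one> Y)"
  for C (structure)

text \<open>\<open>h : A \<odot> Y \<rightarrow> X\<close> is a conditional of \<open>f : A \<rightarrow> X \<odot> Y\<close> with respect to \<open>Y\<close>.\<close>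

definition is_conditional ::
  "('o, 'm, 'z) markov_data_scheme \<Rightarrow> 'o \<Rightarrow> 'o \<Rightarrow> 'o \<Rightarrow> 'm \<Rightarrow> 'm \<Rightarrow> bool"
  where "is_conditional C A X Y f h \<longleftrightarrow>
    \<guillemotleft>f : A \<rightarrow> X \<odot> Y\<guillemotright> \<and> \<guillemotleft>h : A \<odot> Y \<rightarrow> X\<guillemotright> \<and>
    f = (h \<otimes> \<one> Y) \<cdot> \<alpha>_inv A Y Y \<cdot> (\<one> A \<otimes> \<Delta> Y) \<cdot> (\<one> A \<otimes> (proj_right C X Y \<cdot> f)) \<cdot> \<Delta> A"
  for C (structure)

definition has_conditionals :: "('o, 'm, 'z) markov_data_scheme \<Rightarrow> bool"
  where "has_conditionals C \<longleftrightarrow>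
    (\<forall>A\<in>Obj C. \<forall>X\<in>Obj C. \<forall>Y\<in>Obj C. \<forall>f. \<guillemotleft>f : A \<rightarrow> X \<odot> Y\<guillemotright> \<longrightarrow> (\<exists>h. is_conditional C A X Y f h))"
  for C (structure)

text \<open>\<open>a\<close> and \<open>b\<close> are required to be parallel morphisms out of the codomain of \<open>q\<close>.\<close>

definition as_eq :: "('o, 'm, 'z) markov_data_scheme \<Rightarrow> 'm \<Rightarrow> 'm \<Rightarrow> 'm \<Rightarrow> bool"
  where "as_eq C q a b \<longleftrightarrow>
    (\<exists>W A X. \<guillemotleft>q : W \<rightarrow> A\<guillemotright> \<and> \<guillemotleft>a : A \<rightarrow> X\<guillemotright> \<and> \<guillemotleft>b : A \<rightarrow> X\<guillemotright> \<and>
      (\<one> A \<otimes> a) \<cdot> \<Delta> A \<cdot> q = (\<one> A \<otimes> b) \<cdot> \<Delta> A \<cdot> q)"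
  for C (structure)


section \<open>Representability\<close>

definition is_representation ::
  "('o, 'm, 'z) markov_data_scheme \<Rightarrow> ('o \<Rightarrow> 'o) \<Rightarrow> ('o \<Rightarrow> 'm) \<Rightarrow> bool"
  where "is_representation C P samp \<longleftrightarrow>
    (\<forall>X\<in>Obj C. P X \<in> Obj C \<and> \<guillemotleft>samp X : P X \<rightarrow> X\<guillemotright> \<and>
      (\<forall>A f. \<guillemotleft>f : A \<rightarrow> X\<guillemotright> \<longrightarrow>
        (\<exists>!h. \<guillemotleft>h : A \<rightarrow> P X\<guillemotright> \<and> deterministic C h \<and> f = samp X \<cdot> h)))"
  for C (structure)

definition det_counterpart ::
  "('o, 'm, 'z) markov_data_scheme \<Rightarrow> ('o \<Rightarrow> 'o) \<Rightarrow> ('o \<Rightarrow> 'm) \<Rightarrow> 'm \<Rightarrow> 'm"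
  where "det_counterpart C P samp f =
    (THE h. \<guillemotleft>h : Dom C f \<rightarrow> P (Cod C f)\<guillemotright> \<and> deterministic C h \<and> f = samp (Cod C f) \<cdot> h)"
  for C (structure)

definition as_compatible_representation ::
  "('o, 'm, 'z) markov_data_scheme \<Rightarrow> ('o \<Rightarrow> 'o) \<Rightarrow> ('o \<Rightarrow> 'm) \<Rightarrow> bool"
  where "as_compatible_representation C P samp \<longleftrightarrow>
    is_representation C P samp \<and>
    (\<forall>q a b. as_eq C q a b \<longrightarrow>
      as_eq C q (det_counterpart C P samp a) (det_counterpart C P samp b))"
  for C (structure)


section \<open>Finite tensor products\<close>

text \<open>\<open>tens_obj C F t\<close> is \<open>F\<^sub>0 \<odot> \<dots> \<odot> F\<^sub>t\<close>, bracketed to the left, and similarly for morphisms.\<close>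

primrec tens_obj :: "('o, 'm, 'z) markov_data_scheme \<Rightarrow> (nat \<Rightarrow> 'o) \<Rightarrow> nat \<Rightarrow> 'o" where
  "tens_obj C F 0 = F 0"
| "tens_obj C F (Suc t) = tens_obj C F t \<odot>\<^bsub>C\<^esub> F (Suc t)"

primrec tens_mor :: "('o, 'm, 'z) markov_data_scheme \<Rightarrow> (nat \<Rightarrow> 'm) \<Rightarrow> nat \<Rightarrow> 'm" where
  "tens_mor C h 0 = h 0"
| "tens_mor C h (Suc t) = tens_mor C h t \<otimes>\<^bsub>C\<^esub> h (Suc t)"

text \<open>
  \<open>tens_trunc C F t n\<close> deletes the factors with index in \<open>{t+1..n}\<close>; it is a morphism
  \<open>F\<^sub>0 \<odot> \<dots> \<odot> F\<^sub>n \<rightarrow> F\<^sub>0 \<odot> \<dots> \<odot> F\<^sub>t\<close> for \<open>t \<le> n\<close>.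
\<close>

primrec tens_trunc ::
  "('o, 'm, 'z) markov_data_scheme \<Rightarrow> (nat \<Rightarrow> 'o) \<Rightarrow> nat \<Rightarrow> nat \<Rightarrow> 'm" where
  "tens_trunc C F t 0 = \<one>\<^bsub>C\<^esub> (F 0)"
| "tens_trunc C F t (Suc n) =
    (if Suc n \<le> t then \<one>\<^bsub>C\<^esub> (tens_obj C F (Suc n))
     else tens_trunc C F t n \<cdot>\<^bsub>C\<^esub> proj_left C (tens_obj C F n) (F (Suc n)))"


section \<open>Hidden Markov models\<close>

text \<open>\<open>prev_obj C X t\<close> is \<open>X\<^sub>t\<^sub>-\<^sub>1\<close>, with the convention \<open>X\<^sub>-\<^sub>1 = \<I>\<close>.\<close>

definition prev_obj :: "('o, 'm, 'z) markov_data_scheme \<Rightarrow> (nat \<Rightarrow> 'o) \<Rightarrow> nat \<Rightarrow> 'o"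
  where "prev_obj C X t = (case t of 0 \<Rightarrow> \<I>\<^bsub>C\<^esub> | Suc s \<Rightarrow> X s)"

definition hmm_kernels ::
  "('o, 'm, 'z) markov_data_scheme \<Rightarrow> (nat \<Rightarrow> 'o) \<Rightarrow> (nat \<Rightarrow> 'o) \<Rightarrow> (nat \<Rightarrow> 'm) \<Rightarrow> (nat \<Rightarrow> 'm)
    \<Rightarrow> nat \<Rightarrow> bool"
  where "hmm_kernels C X Y f g n \<longleftrightarrow>
    (\<forall>t\<le>n. X t \<in> Obj C \<and> Y t \<in> Obj C \<and>
      \<guillemotleft>f t : prev_obj C X t \<rightarrow> X t\<guillemotright> \<and> \<guillemotleft>g t : X t \<rightarrow> Y t\<guillemotright>)"
  for C (structure)

text \<open>
  The joint state \<open>m\<^sub>t\<close> of \<open>X\<^sub>0, \<dots>, X\<^sub>t\<close>. For \<open>t = 1\<close> the untouched factor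
  \<open>X\<^sub>0 \<odot> \<dots> \<odot> X\<^sub>t\<^sub>-\<^sub>2\<close> is empty.
\<close>

fun hidden_chain ::
  "('o, 'm, 'z) markov_data_scheme \<Rightarrow> (nat \<Rightarrow> 'o) \<Rightarrow> (nat \<Rightarrow> 'm) \<Rightarrow> nat \<Rightarrow> 'm" where
  "hidden_chain C X f 0 = f 0"
| "hidden_chain C X f (Suc 0) =
    ((\<one>\<^bsub>C\<^esub> (X 0) \<otimes>\<^bsub>C\<^esub> f 1) \<cdot>\<^bsub>C\<^esub> \<Delta>\<^bsub>C\<^esub> (X 0)) \<cdot>\<^bsub>C\<^esub> hidden_chain C X f 0"
| "hidden_chain C X f (Suc (Suc s)) =
    \<alpha>_inv\<^bsub>C\<^esub> (tens_obj C X s) (X (Suc s)) (X (Suc (Suc s)))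
      \<cdot>\<^bsub>C\<^esub> (\<one>\<^bsub>C\<^esub> (tens_obj C X s)
            \<otimes>\<^bsub>C\<^esub> ((\<one>\<^bsub>C\<^esub> (X (Suc s)) \<otimes>\<^bsub>C\<^esub> f (Suc (Suc s))) \<cdot>\<^bsub>C\<^esub> \<Delta>\<^bsub>C\<^esub> (X (Suc s))))
      \<cdot>\<^bsub>C\<^esub> hidden_chain C X f (Suc s)"

definition hmm_state ::
  "('o, 'm, 'z) markov_data_scheme \<Rightarrow> (nat \<Rightarrow> 'o) \<Rightarrow> (nat \<Rightarrow> 'm) \<Rightarrow> (nat \<Rightarrow> 'm) \<Rightarrow> nat \<Rightarrow> 'm"
  where "hmm_state C X f g n =
    tens_mor C (\<lambda>t. (\<one> (X t) \<otimes> g t) \<cdot> \<Delta> (X t)) n \<cdot> hidden_chain C X f n"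
  for C (structure)

text \<open>
  Marginals of a state \<open>p\<close> of \<open>(X\<^sub>0 \<odot> Y\<^sub>0) \<odot> \<dots> \<odot> (X\<^sub>n \<odot> Y\<^sub>n)\<close>, for \<open>t \<le> n\<close>:
  \<open>marg_obs\<close> on \<open>Y\<^sub>0 \<odot> \<dots> \<odot> Y\<^sub>t\<close>, and \<open>marg_obs_hidden\<close> on \<open>Y\<^sub>0 \<odot> \<dots> \<odot> Y\<^sub>t\<close> and \<open>X\<^sub>t\<close>. The latter
  lists \<open>X\<^sub>t\<close> first, which is the order expected by \<open>is_conditional\<close>; \<open>pull_hidden\<close> is the map
  \<open>(X\<^sub>0 \<odot> Y\<^sub>0) \<odot> \<dots> \<odot> (X\<^sub>t \<odot> Y\<^sub>t) \<rightarrow> X\<^sub>t \<odot> (Y\<^sub>0 \<odot> \<dots> \<odot> Y\<^sub>t)\<close> deleting all \<open>X\<^sub>s\<close> with \<open>s < t\<close>.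
\<close>

definition marg_obs ::
  "('o, 'm, 'z) markov_data_scheme \<Rightarrow> (nat \<Rightarrow> 'o) \<Rightarrow> (nat \<Rightarrow> 'o) \<Rightarrow> nat \<Rightarrow> 'm \<Rightarrow> nat \<Rightarrow> 'm"
  where "marg_obs C X Y n p t =
    tens_mor C (\<lambda>s. proj_right C (X s) (Y s)) t \<cdot> tens_trunc C (\<lambda>s. X s \<odot> Y s) t n \<cdot> p"
  for C (structure)

definition pull_hidden ::
  "('o, 'm, 'z) markov_data_scheme \<Rightarrow> (nat \<Rightarrow> 'o) \<Rightarrow> (nat \<Rightarrow> 'o) \<Rightarrow> nat \<Rightarrow> 'm"
  where "pull_hidden C X Y t =
    (case t of
       0 \<Rightarrow> \<one> (X 0 \<odot> Y 0)
     | Suc s \<Rightarrow>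
         \<alpha> (X t) (tens_obj C Y s) (Y t)
           \<cdot> (\<sigma> (tens_obj C Y s) (X t) \<otimes> \<one> (Y t))
           \<cdot> \<alpha>_inv (tens_obj C Y s) (X t) (Y t)
           \<cdot> (tens_mor C (\<lambda>r. proj_right C (X r) (Y r)) s \<otimes> \<one> (X t \<odot> Y t)))"
  for C (structure)

definition marg_obs_hidden ::
  "('o, 'm, 'z) markov_data_scheme \<Rightarrow> (nat \<Rightarrow> 'o) \<Rightarrow> (nat \<Rightarrow> 'o) \<Rightarrow> nat \<Rightarrow> 'm \<Rightarrow> nat \<Rightarrow> 'm"
  where "marg_obs_hidden C X Y n p t =
    pull_hidden C X Y t \<cdot> tens_trunc C (\<lambda>s. X s \<odot> Y s) t n \<cdot> p"
  for C (structure)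


section \<open>Bayes filter and update maps\<close>

text \<open>
  A conditional of a state \<open>\<I> \<rightarrow> X \<odot> Y\<close> has domain \<open>\<I> \<odot> Y\<close>; the unitor turns a morphism
  out of \<open>Y\<close> into one of this type.
\<close>

definition is_bayes_filter ::
  "('o, 'm, 'z) markov_data_scheme \<Rightarrow> (nat \<Rightarrow> 'o) \<Rightarrow> (nat \<Rightarrow> 'o) \<Rightarrow> nat \<Rightarrow> 'm \<Rightarrow> nat \<Rightarrow> 'm \<Rightarrow> bool"
  where "is_bayes_filter C X Y n p t b \<longleftrightarrow>
    \<guillemotleft>b : tens_obj C Y t \<rightarrow> X t\<guillemotright> \<and>
    is_conditional C \<I> (X t) (tens_obj C Y t) (marg_obs_hidden C X Y n p t) (b \<cdot> \<ell> (tens_obj C Y t))"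
  for C (structure)

text \<open>\<open>v : P A \<odot> Y \<rightarrow> X\<close> is an update map for the kernels \<open>k : A \<rightarrow> X\<close> and \<open>l : X \<rightarrow> Y\<close>.\<close>

definition is_update_map ::
  "('o, 'm, 'z) markov_data_scheme \<Rightarrow> ('o \<Rightarrow> 'o) \<Rightarrow> ('o \<Rightarrow> 'm) \<Rightarrow> 'o \<Rightarrow> 'o \<Rightarrow> 'o \<Rightarrow> 'm \<Rightarrow> 'm \<Rightarrow> 'm
    \<Rightarrow> bool"
  where "is_update_map C P samp A X Y k l v \<longleftrightarrow>
    is_conditional C (P A) X Y ((\<one> X \<otimes> l) \<cdot> \<Delta> X \<cdot> k \<cdot> samp A) v"
  for C (structure)

text \<open>
  \<open>pad_right C Y h s t\<close> is \<open>h \<otimes> \<one>\<close> with the identity of \<open>Y\<^sub>s\<^sub>+\<^sub>1 \<odot> \<dots> \<odot> Y\<^sub>t\<close>, where domain and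
  codomain are bracketed to the left: \<open>(\<dots> (h \<otimes> \<one> Y\<^sub>s\<^sub>+\<^sub>1) \<otimes> \<dots>) \<otimes> \<one> Y\<^sub>t\<close>.
\<close>

definition pad_right ::
  "('o, 'm, 'z) markov_data_scheme \<Rightarrow> (nat \<Rightarrow> 'o) \<Rightarrow> 'm \<Rightarrow> nat \<Rightarrow> nat \<Rightarrow> 'm"
  where "pad_right C Y h s t = foldl (\<lambda>k i. k \<otimes> \<one> (Y i)) h [Suc s..<Suc t]"
  for C (structure)

text \<open>\<open>comp_seq C h t\<close> is \<open>h\<^sub>t \<cdot> h\<^sub>t\<^sub>-\<^sub>1 \<cdot> \<dots> \<cdot> h\<^sub>0\<close>.\<close>

primrec comp_seq :: "('o, 'm, 'z) markov_data_scheme \<Rightarrow> (nat \<Rightarrow> 'm) \<Rightarrow> nat \<Rightarrow> 'm" where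
  "comp_seq C h 0 = h 0"
| "comp_seq C h (Suc t) = h (Suc t) \<cdot>\<^bsub>C\<^esub> comp_seq C h t"

text \<open>
  The composite \<open>v\<^sub>t \<cdot> (v\<^sub>t\<^sub>-\<^sub>1 \<otimes> \<one>) \<cdot> \<dots> \<cdot> (v\<^sub>0 \<otimes> \<one>)\<close>, where \<open>v\<^sub>0\<close> has domain \<open>Y\<^sub>0\<close>.
\<close>

definition iterated_update ::
  "('o, 'm, 'z) markov_data_scheme \<Rightarrow> (nat \<Rightarrow> 'o) \<Rightarrow> (nat \<Rightarrow> 'm) \<Rightarrow> nat \<Rightarrow> 'm"
  where "iterated_update C Y v t = comp_seq C (\<lambda>s. pad_right C Y (v s) s t) t"

end

theory Submission
  imports Defs
begin

text \<open>
  It suffices to show that the iterated update \<open>w\<^sub>t\<close> satisfies \<open>samp \<cdot> w\<^sub>t = BF\<^sub>t\<close> almost surely: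
  \<open>w\<^sub>t\<close> is deterministic, hence it is the deterministic counterpart of \<open>samp \<cdot> w\<^sub>t\<close>, and the
  other claim is a.s.-compatibility. This is an induction on \<open>t\<close>. By the induction hypothesis,
  the joint law of \<open>Y\<^sub>0, \<dots>, Y\<^sub>t, X\<^sub>t\<^sub>+\<^sub>1, Y\<^sub>t\<^sub>+\<^sub>1\<close> is obtained from that of \<open>Y\<^sub>0, \<dots>, Y\<^sub>t\<close> by
  applying \<open>k \<cdot> samp \<cdot> w\<^sub>t\<close> to a copy, where \<open>k : X\<^sub>t \<rightarrow> X\<^sub>t\<^sub>+\<^sub>1 \<odot> Y\<^sub>t\<^sub>+\<^sub>1\<close>. As \<open>w\<^sub>t\<close> commutes with
  copying, the conditional \<open>u\<^sub>t\<^sub>+\<^sub>1\<close> of \<open>k \<cdot> samp\<close> restricts to a conditional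
  \<open>u\<^sub>t\<^sub>+\<^sub>1 \<cdot> (w\<^sub>t \<otimes> \<one>) = samp \<cdot> w\<^sub>t\<^sub>+\<^sub>1\<close> of \<open>k \<cdot> samp \<cdot> w\<^sub>t\<close>, and coassociativity turns it into a
  conditional given all of \<open>Y\<^sub>0, \<dots>, Y\<^sub>t\<^sub>+\<^sub>1\<close>, as \<open>BF\<^sub>t\<^sub>+\<^sub>1\<close> is.
\<close>

section \<open>Coherence\<close>

context category
begin

text \<open>The locale axioms type morphisms by \<open>in_hom\<close>, whose middle objects cannot
  be read off a composite. Here and below they are restated through \<open>Arr\<close>,
  \<open>Dom\<close> and \<open>Cod\<close>, so that rewriting can check composability
  itself.\<close>

lemma ident_simps [simp]:
  assumes "A \<in> Obj C"
  shows "\<one> A \<in> Arr C" "Dom C (\<one> A) = A" "Cod C (\<one> A) = A"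
  using ident_hom[OF assms] by (auto simp: in_hom_def)

lemma comp_simps [simp]:
  assumes "f \<in> Arr C" "g \<in> Arr C" "Cod C f = Dom C g"
  shows "g \<cdot> f \<in> Arr C" "Dom C (g \<cdot> f) = Dom C f" "Cod C (g \<cdot> f) = Cod C g"
  using comp_hom[of f "Dom C f" "Cod C f" g "Cod C g"] assms by (auto simp: in_hom_def)

lemma comp_ident [simp]:
  assumes "f \<in> Arr C"
  shows "Dom C f = A \<Longrightarrow> f \<cdot> \<one> A = f" "Cod C f = B \<Longrightarrow> \<one> B \<cdot> f = f"
  using assms comp_ident_right comp_ident_left by (auto simp: in_hom_def)

lemma assoc_comp [simp]:
  assumes "f \<in> Arr C" "g \<in> Arr C" "h \<in> Arr C" "Cod C f = Dom C g" "Cod C g = Dom C h"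
  shows "(h \<cdot> g) \<cdot> f = h \<cdot> g \<cdot> f"
  using comp_assoc[of f "Dom C f" "Cod C f" g "Cod C g" h "Cod C h"] assms
  by (simp add: in_hom_def)

lemma in_homD:
  assumes "\<guillemotleft>f : A \<rightarrow> B\<guillemotright>"
  shows "f \<in> Arr C" "Dom C f = A" "Cod C f = B" "A \<in> Obj C" "B \<in> Obj C"
  using assms dom_obj[of f] cod_obj[of f] by (auto simp: in_hom_def)

text \<open>Composites are normalised by bracketing to the right, which hides
  \<open>g \<cdot> f\<close> inside \<open>g \<cdot> f \<cdot> r\<close>; this lifts an equation to
  that position.\<close>

lemma comp_reassoc:
  assumes "g \<cdot> f = h" "f \<in> Arr C" "g \<in> Arr C" "Cod C f = Dom C g" "r \<in> Arr C" "Cod C r = Dom C f"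
  shows "g \<cdot> f \<cdot> r = h \<cdot> r"
  using assms by (metis assoc_comp)

declare dom_obj [simp] cod_obj [simp]

end

section \<open>Monoidal coherence: naturality, pentagon and unit laws\<close>

context monoidal_category
begin

declare unit_obj [simp] tensor_obj [simp] tensor_ident [simp]

lemma tensor_simps [simp]:
  assumes "f \<in> Arr C" "g \<in> Arr C"
  shows "f \<otimes> g \<in> Arr C" "Dom C (f \<otimes> g) = Dom C f \<odot> Dom C g"
    "Cod C (f \<otimes> g) = Cod C f \<odot> Cod C g"
  using tensor_hom[of f "Dom C f" "Cod C f" g "Dom C g" "Cod C g"] assms
  by (auto simp: in_hom_def)

text \<open>Oriented so that stacked tensor products merge into one; where a layered form has to
  survive, the rule is switched off.\<close>

lemma interchange [simp]:
  assumes "f \<in> Arr C" "g \<in> Arr C" "f' \<in> Arr C" "g' \<in> Arr C"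
    "Cod C f = Dom C g" "Cod C f' = Dom C g'"
  shows "(g \<otimes> g') \<cdot> (f \<otimes> f') = (g \<cdot> f) \<otimes> (g' \<cdot> f')"
  using tensor_comp[of f "Dom C f" "Cod C f" g "Cod C g" f' "Dom C f'" "Cod C f'" g'
      "Cod C g'"] assms
  by (simp add: in_hom_def)

lemma interchange_comp [simp]:
  assumes "f \<in> Arr C" "g \<in> Arr C" "f' \<in> Arr C" "g' \<in> Arr C"
    "Cod C f = Dom C g" "Cod C f' = Dom C g'" "r \<in> Arr C" "Cod C r = Dom C f \<odot> Dom C f'"
  shows "(g \<otimes> g') \<cdot> (f \<otimes> f') \<cdot> r = ((g \<cdot> f) \<otimes> (g' \<cdot> f')) \<cdot> r"
  using assms by (subst assoc_comp[symmetric]) auto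

lemma assoc_simps [simp]:
  assumes "A \<in> Obj C" "B \<in> Obj C" "D \<in> Obj C"
  shows "\<alpha> A B D \<in> Arr C" "Dom C (\<alpha> A B D) = A \<odot> B \<odot> D" "Cod C (\<alpha> A B D) = A \<odot> (B \<odot> D)"
    "\<alpha>_inv A B D \<in> Arr C" "Dom C (\<alpha>_inv A B D) = A \<odot> (B \<odot> D)" "Cod C (\<alpha>_inv A B D) = A \<odot> B \<odot> D"
    "\<alpha>_inv A B D \<cdot> \<alpha> A B D = \<one> (A \<odot> B \<odot> D)"
    "\<alpha> A B D \<cdot> \<alpha>_inv A B D = \<one> (A \<odot> (B \<odot> D))"
  using assoc_hom assoc_inv_hom assoc_inv_left assoc_inv_right assms by (auto simp: in_hom_def)

lemma unitor_simps [simp]: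
  assumes "A \<in> Obj C"
  shows "\<ell> A \<in> Arr C" "Dom C (\<ell> A) = \<I> \<odot> A" "Cod C (\<ell> A) = A"
    "\<ell>_inv A \<in> Arr C" "Dom C (\<ell>_inv A) = A" "Cod C (\<ell>_inv A) = \<I> \<odot> A"
    "\<ell>_inv A \<cdot> \<ell> A = \<one> (\<I> \<odot> A)" "\<ell> A \<cdot> \<ell>_inv A = \<one> A"
    "\<rho> A \<in> Arr C" "Dom C (\<rho> A) = A \<odot> \<I>" "Cod C (\<rho> A) = A"
    "\<rho>_inv A \<in> Arr C" "Dom C (\<rho>_inv A) = A" "Cod C (\<rho>_inv A) = A \<odot> \<I>"
    "\<rho>_inv A \<cdot> \<rho> A = \<one> (A \<odot> \<I>)" "\<rho> A \<cdot> \<rho>_inv A = \<one> A"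
  using lunit_hom lunit_inv_hom runit_hom runit_inv_hom lunit_inv_left lunit_inv_right
    runit_inv_left runit_inv_right assms by (auto simp: in_hom_def)

lemma assoc_cancel [simp]:
  assumes "A \<in> Obj C" "B \<in> Obj C" "D \<in> Obj C" "r \<in> Arr C"
  shows "Cod C r = A \<odot> B \<odot> D \<Longrightarrow> \<alpha>_inv A B D \<cdot> \<alpha> A B D \<cdot> r = r"
    "Cod C r = A \<odot> (B \<odot> D) \<Longrightarrow> \<alpha> A B D \<cdot> \<alpha>_inv A B D \<cdot> r = r"
  using assms by (simp_all add: assoc_comp[symmetric] del: assoc_comp)

lemma assoc_nat:
  assumes "f \<in> Arr C" "g \<in> Arr C" "h \<in> Arr C" "Cod C f = A" "Cod C g = B" "Cod C h = D"
  shows "\<alpha> A B D \<cdot> (f \<otimes> g \<otimes> h) = (f \<otimes> (g \<otimes> h)) \<cdot> \<alpha> (Dom C f) (Dom C g) (Dom C h)"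
  using assoc_natural[of f "Dom C f" A g "Dom C g" B h "Dom C h" D] assms by (simp add: in_hom_def)

text \<open>Naturality of \<open>\<alpha>\<close>, conjugated: insert
  \<open>\<alpha> \<cdot> \<alpha>_inv\<close> on the right, move \<open>\<alpha>\<close> across the
  tensor product and cancel it on the left.\<close>

lemma assoc_inv_nat:
  assumes "f \<in> Arr C" "g \<in> Arr C" "h \<in> Arr C" "Cod C f = A" "Cod C g = B" "Cod C h = D"
  shows "\<alpha>_inv A B D \<cdot> (f \<otimes> (g \<otimes> h)) = (f \<otimes> g \<otimes> h) \<cdot> \<alpha>_inv (Dom C f) (Dom C g) (Dom C h)"
proof -
  have "A \<in> Obj C" "B \<in> Obj C" "D \<in> Obj C"
    using assms by auto
  then have "\<alpha>_inv A B D \<cdot> (f \<otimes> (g \<otimes> h)) = 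
     \<alpha>_inv A B D \<cdot> ((f \<otimes> (g \<otimes> h)) \<cdot> \<alpha> (Dom C f) (Dom C g) (Dom C h))
         \<cdot> \<alpha>_inv (Dom C f) (Dom C g) (Dom C h)"
    using assms(1-3) assms(4-6)[symmetric] by simp
  also have "\<dots> = \<alpha>_inv A B D \<cdot> (\<alpha> A B D \<cdot> (f \<otimes> g \<otimes> h)) \<cdot> \<alpha>_inv (Dom C f) (Dom C g) (Dom C h)"
    using assoc_nat[OF assms] by simp
  also have "\<dots> = (f \<otimes> g \<otimes> h) \<cdot> \<alpha>_inv (Dom C f) (Dom C g) (Dom C h)"
    using assms(1-3) assms(4-6)[symmetric] by simp
  finally show ?thesis .
qed

lemma assoc_nat_comp:
  assumes "f \<in> Arr C" "g \<in> Arr C" "h \<in> Arr C" "Cod C f = A" "Cod C g = B" "Cod C h = D"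
    "r \<in> Arr C" "Cod C r = Dom C f \<odot> Dom C g \<odot> Dom C h"
  shows "\<alpha> A B D \<cdot> (f \<otimes> g \<otimes> h) \<cdot> r = (f \<otimes> (g \<otimes> h)) \<cdot> \<alpha> (Dom C f) (Dom C g) (Dom C h) \<cdot> r"
  using assms comp_reassoc[OF assoc_nat[OF assms(1-6)] _ _ _ assms(7)] by fastforce

text \<open>Naturality of the unitors recovers a morphism from its tensor product with
  \<open>\<one> \<I>\<close> by conjugation.\<close>

lemma unit_tensor_faithful:
  assumes "f \<in> Arr C" "g \<in> Arr C" "Dom C f = Dom C g" "Cod C f = Cod C g"
  shows "\<one> \<I> \<otimes> f = \<one> \<I> \<otimes> g \<Longrightarrow> f = g" "f \<otimes> \<one> \<I> = g \<otimes> \<one> \<I> \<Longrightarrow> f = g"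
proof -
  have *: "h = \<ell> (Cod C h) \<cdot> (\<one> \<I> \<otimes> h) \<cdot> \<ell>_inv (Dom C h)"
    "h = \<rho> (Cod C h) \<cdot> (h \<otimes> \<one> \<I>) \<cdot> \<rho>_inv (Dom C h)" if "h \<in> Arr C" for h
  proof -
    have h: "\<guillemotleft>h : Dom C h \<rightarrow> Cod C h\<guillemotright>"
      using that by (simp add: in_hom_def)
    show "h = \<ell> (Cod C h) \<cdot> (\<one> \<I> \<otimes> h) \<cdot> \<ell>_inv (Dom C h)"
      using comp_reassoc[OF lunit_natural[OF h], of "\<ell>_inv (Dom C h)"] that by simp
    show "h = \<rho> (Cod C h) \<cdot> (h \<otimes> \<one> \<I>) \<cdot> \<rho>_inv (Dom C h)"
      using comp_reassoc[OF runit_natural[OF h], of "\<rho>_inv (Dom C h)"] that by simp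
  qed
  show "\<one> \<I> \<otimes> f = \<one> \<I> \<otimes> g \<Longrightarrow> f = g" "f \<otimes> \<one> \<I> = g \<otimes> \<one> \<I> \<Longrightarrow> f = g"
    using *[OF assms(1)] *[OF assms(2)] assms by auto
qed

text \<open>The pentagon solved for \<open>\<alpha> A B (D \<odot> E)\<close>; the companion below
  solves it for \<open>\<alpha> (A \<odot> B) D E\<close>.\<close>

lemma pentagon_inv:
  assumes [simp]: "A \<in> Obj C" "B \<in> Obj C" "D \<in> Obj C" "E \<in> Obj C"
  shows "\<alpha>_inv A (B \<odot> D) E \<cdot> (\<one> A \<otimes> \<alpha>_inv B D E) \<cdot> \<alpha> A B (D \<odot> E)
    = (\<alpha> A B D \<otimes> \<one> E) \<cdot> \<alpha>_inv (A \<odot> B) D E"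
proof -
  have "\<alpha> A B (D \<odot> E) = ((\<one> A \<otimes> \<alpha> B D E) \<cdot> \<alpha> A (B \<odot> D) E \<cdot> (\<alpha> A B D \<otimes> \<one> E)) \<cdot> \<alpha>_inv (A \<odot> B) D E"
    by (subst pentagon) auto
  then show ?thesis
    by simp
qed

lemma pentagon_inv':
  assumes [simp]: "A \<in> Obj C" "B \<in> Obj C" "D \<in> Obj C" "E \<in> Obj C"
  shows "\<alpha>_inv A B (D \<odot> E) \<cdot> (\<one> A \<otimes> \<alpha> B D E) \<cdot> \<alpha> A (B \<odot> D) E
    = \<alpha> (A \<odot> B) D E \<cdot> (\<alpha>_inv A B D \<otimes> \<one> E)"
proof -
  have "\<alpha> (A \<odot> B) D E = \<alpha>_inv A B (D \<odot> E) \<cdot> ((\<one> A \<otimes> \<alpha> B D E) \<cdot> \<alpha> A (B \<odot> D) E \<cdot> (\<alpha> A B D \<otimes> \<one> E))"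
    by (subst pentagon) auto
  then show ?thesis
    by simp
qed

lemma iso_cancel_right:
  assumes "f \<cdot> i = g \<cdot> i" "i \<cdot> j = \<one> (Cod C i)" "f \<in> Arr C" "g \<in> Arr C" "i \<in> Arr C" "j \<in> Arr C"
    "Dom C f = Cod C i" "Dom C g = Cod C i" "Cod C j = Dom C i"
  shows "f = g"
  using assms by (metis assoc_comp comp_ident(1))

lemma iso_cancel_left:
  assumes "i \<cdot> f = i \<cdot> g" "j \<cdot> i = \<one> (Dom C i)" "f \<in> Arr C" "g \<in> Arr C" "i \<in> Arr C" "j \<in> Arr C"
    "Cod C f = Dom C i" "Cod C g = Dom C i" "Cod C i = Dom C j"
  shows "f = g"
  using assms by (metis assoc_comp comp_ident(2))

text \<open>Kelly's argument: tensoring with \<open>\<I>\<close> is faithful, and after tensoring the pentagon applies.\<close>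

lemma lunit_tensor:
  assumes [simp]: "A \<in> Obj C" "B \<in> Obj C"
  shows "\<ell> (A \<odot> B) \<cdot> \<alpha> \<I> A B = \<ell> A \<otimes> \<one> B"
proof -
  \<comment> \<open>\<open>?i\<close> is the first two edges of the long side of the pentagon for
    \<open>\<I>\<close>, \<open>\<I>\<close>, \<open>A\<close>, \<open>B\<close>; being invertible,
    it can be cancelled at the end.\<close>
  let ?i = "\<alpha> \<I> (\<I> \<odot> A) B \<cdot> (\<alpha> \<I> \<I> A \<otimes> \<one> B)"
  have "(\<one> \<I> \<otimes> (\<ell> (A \<odot> B) \<cdot> \<alpha> \<I> A B)) \<cdot> ?i
    = (\<one> \<I> \<otimes> \<ell> (A \<odot> B)) \<cdot> (\<one> \<I> \<otimes> \<alpha> \<I> A B) \<cdot> ?i"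
    by simp
  also have "\<dots> = ((\<one> \<I> \<otimes> \<ell> (A \<odot> B)) \<cdot> \<alpha> \<I> \<I> (A \<odot> B)) \<cdot> \<alpha> (\<I> \<odot> \<I>) A B"
    by (subst pentagon) auto
  also have "\<dots> = (\<rho> \<I> \<otimes> \<one> (A \<odot> B)) \<cdot> \<alpha> (\<I> \<odot> \<I>) A B"
    by (subst triangle) auto
  also have "\<dots> = \<alpha> \<I> A B \<cdot> (\<rho> \<I> \<otimes> \<one> A \<otimes> \<one> B)"
    by (simp add: assoc_nat)
  also have "\<dots> = \<alpha> \<I> A B \<cdot> (((\<one> \<I> \<otimes> \<ell> A) \<cdot> \<alpha> \<I> \<I> A) \<otimes> \<one> B)"
    by (subst triangle) auto
  also have "\<dots> = \<alpha> \<I> A B \<cdot> (\<one> \<I> \<otimes> \<ell> A \<otimes> \<one> B) \<cdot> (\<alpha> \<I> \<I> A \<otimes> \<one> B)"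
    by simp
  also have "\<dots> = (\<one> \<I> \<otimes> (\<ell> A \<otimes> \<one> B)) \<cdot> ?i"
    by (subst assoc_nat_comp) auto
  finally have "(\<one> \<I> \<otimes> (\<ell> (A \<odot> B) \<cdot> \<alpha> \<I> A B)) = (\<one> \<I> \<otimes> (\<ell> A \<otimes> \<one> B))"
    by (rule iso_cancel_right[where j = "(\<alpha>_inv \<I> \<I> A \<otimes> \<one> B) \<cdot> \<alpha>_inv \<I> (\<I> \<odot> A) B"]) auto
  then show ?thesis
    by (rule unit_tensor_faithful(1)[rotated -1]) auto
qed

text \<open>Mirror image of the preceding argument: \<open>\<I>\<close> is tensored on the right,
  and the triangle is applied once at \<open>B\<close> and once at
  \<open>A \<odot> B\<close>.\<close>

lemma runit_tensor:
  assumes [simp]: "A \<in> Obj C" "B \<in> Obj C"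
  shows "(\<one> A \<otimes> \<rho> B) \<cdot> \<alpha> A B \<I> = \<rho> (A \<odot> B)"
proof -
  let ?a = "\<alpha> A (B \<odot> \<I>) \<I> \<cdot> (\<alpha> A B \<I> \<otimes> \<one> \<I>)"
  have "\<alpha> A B \<I> \<cdot> (((\<one> A \<otimes> \<rho> B) \<cdot> \<alpha> A B \<I>) \<otimes> \<one> \<I>)
    = \<alpha> A B \<I> \<cdot> (\<one> A \<otimes> \<rho> B \<otimes> \<one> \<I>) \<cdot> (\<alpha> A B \<I> \<otimes> \<one> \<I>)"
    by simp
  also have "\<dots> = (\<one> A \<otimes> (\<rho> B \<otimes> \<one> \<I>)) \<cdot> ?a"
    by (subst assoc_nat_comp) auto
  also have "\<dots> = (\<one> A \<otimes> ((\<one> B \<otimes> \<ell> \<I>) \<cdot> \<alpha> B \<I> \<I>)) \<cdot> ?a"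
    by (subst triangle) auto
  also have "\<dots> = (\<one> A \<otimes> (\<one> B \<otimes> \<ell> \<I>)) \<cdot> (\<one> A \<otimes> \<alpha> B \<I> \<I>) \<cdot> ?a"
    by simp
  also have "\<dots> = (\<one> A \<otimes> (\<one> B \<otimes> \<ell> \<I>)) \<cdot> \<alpha> A B (\<I> \<odot> \<I>) \<cdot> \<alpha> (A \<odot> B) \<I> \<I>"
    by (subst pentagon) auto
  also have "\<dots> = \<alpha> A B \<I> \<cdot> (\<one> (A \<odot> B) \<otimes> \<ell> \<I>) \<cdot> \<alpha> (A \<odot> B) \<I> \<I>"
    by (simp add: assoc_nat_comp flip: tensor_ident)
  also have "\<dots> = \<alpha> A B \<I> \<cdot> (\<rho> (A \<odot> B) \<otimes> \<one> \<I>)"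
    by (subst triangle) auto
  finally have "((\<one> A \<otimes> \<rho> B) \<cdot> \<alpha> A B \<I>) \<otimes> \<one> \<I> = \<rho> (A \<odot> B) \<otimes> \<one> \<I>"
    by (rule iso_cancel_left[where j = "\<alpha>_inv A B \<I>"]) auto
  then show ?thesis
    by (rule unit_tensor_faithful(2)[rotated -1]) auto
qed

lemma triangle_inv:
  assumes [simp]: "A \<in> Obj C" "B \<in> Obj C"
  shows "(\<rho> A \<otimes> \<one> B) \<cdot> \<alpha>_inv A \<I> B = \<one> A \<otimes> \<ell> B"
  by (subst triangle[symmetric]) auto

lemma runit_tensor_inv:
  assumes [simp]: "A \<in> Obj C" "B \<in> Obj C"
  shows "\<rho> (A \<odot> B) \<cdot> \<alpha>_inv A B \<I> = \<one> A \<otimes> \<rho> B"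
  by (subst runit_tensor[symmetric]) auto

end

context symmetric_monoidal_category
begin

lemma swap_simps [simp]:
  assumes "A \<in> Obj C" "B \<in> Obj C"
  shows "\<sigma> A B \<in> Arr C" "Dom C (\<sigma> A B) = A \<odot> B" "Cod C (\<sigma> A B) = B \<odot> A"
    "\<sigma> B A \<cdot> \<sigma> A B = \<one> (A \<odot> B)"
  using swap_hom swap_swap assms by (auto simp: in_hom_def)

lemma swap_nat:
  assumes "f \<in> Arr C" "g \<in> Arr C" "Cod C f = A" "Cod C g = B"
  shows "\<sigma> A B \<cdot> (f \<otimes> g) = (g \<otimes> f) \<cdot> \<sigma> (Dom C f) (Dom C g)"
  using swap_natural[of f "Dom C f" A g "Dom C g" B] assms by (simp add: in_hom_def)

lemma swap_nat_comp:
  assumes "f \<in> Arr C" "g \<in> Arr C" "Cod C f = A" "Cod C g = B" "r \<in> Arr C" "Cod C r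
      = Dom C f \<odot> Dom C g"
  shows "\<sigma> A B \<cdot> (f \<otimes> g) \<cdot> r = (g \<otimes> f) \<cdot> \<sigma> (Dom C f) (Dom C g) \<cdot> r"
  using assms comp_reassoc[OF swap_nat[OF assms(1-4)] _ _ _ assms(5)] by fastforce

text \<open>After tensoring with \<open>\<I>\<close> and composing with
  \<open>\<sigma> A \<I>\<close>, naturality of \<open>\<ell>\<close>, the hexagon with two unit
  objects and \<open>lunit_tensor\<close> reduce the claim to the triangle.\<close>

lemma lunit_swap:
  assumes [simp]: "A \<in> Obj C"
  shows "\<ell> A \<cdot> \<sigma> A \<I> = \<rho> A"
proof -
  have "\<sigma> A \<I> \<cdot> ((\<ell> A \<cdot> \<sigma> A \<I>) \<otimes> \<one> \<I>) = \<sigma> A \<I> \<cdot> (\<ell> A \<otimes> \<one> \<I>) \<cdot> (\<sigma> A \<I> \<otimes> \<one> \<I>)"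
    by simp
  also have "\<dots> = (\<sigma> A \<I> \<cdot> \<ell> (A \<odot> \<I>)) \<cdot> \<alpha> \<I> A \<I> \<cdot> (\<sigma> A \<I> \<otimes> \<one> \<I>)"
    by (subst lunit_tensor[symmetric]) auto
  also have "\<dots> = (\<ell> (\<I> \<odot> A) \<cdot> (\<one> \<I> \<otimes> \<sigma> A \<I>)) \<cdot> \<alpha> \<I> A \<I> \<cdot> (\<sigma> A \<I> \<otimes> \<one> \<I>)"
    by (subst lunit_natural[OF swap_hom]) auto
  also have "\<dots> = \<ell> (\<I> \<odot> A) \<cdot> ((\<one> \<I> \<otimes> \<sigma> A \<I>) \<cdot> \<alpha> \<I> A \<I> \<cdot> (\<sigma> A \<I> \<otimes> \<one> \<I>))"
    by simp
  also have "\<dots> = (\<ell> (\<I> \<odot> A) \<cdot> \<alpha> \<I> \<I> A) \<cdot> \<sigma> A (\<I> \<odot> \<I>) \<cdot> \<alpha> A \<I> \<I>"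
    by (subst hexagon[symmetric]) auto
  also have "\<dots> = (\<ell> \<I> \<otimes> \<one> A) \<cdot> \<sigma> A (\<I> \<odot> \<I>) \<cdot> \<alpha> A \<I> \<I>"
    by (subst lunit_tensor) auto
  also have "\<dots> = \<sigma> A \<I> \<cdot> (\<one> A \<otimes> \<ell> \<I>) \<cdot> \<alpha> A \<I> \<I>"
    by (simp add: swap_nat_comp)
  also have "\<dots> = \<sigma> A \<I> \<cdot> (\<rho> A \<otimes> \<one> \<I>)"
    by (subst triangle) auto
  finally have "(\<ell> A \<cdot> \<sigma> A \<I>) \<otimes> \<one> \<I> = \<rho> A \<otimes> \<one> \<I>"
    by (rule iso_cancel_left[where j = "\<sigma> \<I> A"]) auto
  then show ?thesis
    by (rule unit_tensor_faithful(2)[rotated -1]) auto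
qed

lemma swap_tensor:
  assumes [simp]: "A \<in> Obj C" "B \<in> Obj C" "D \<in> Obj C"
  shows "\<sigma> A (B \<odot> D) \<cdot> \<alpha> A B D
    = \<alpha>_inv B D A \<cdot> (\<one> B \<otimes> \<sigma> A D) \<cdot> \<alpha> B A D \<cdot> (\<sigma> A B \<otimes> \<one> D)"
  by (subst hexagon[symmetric]) auto

text \<open>The added \<open>\<sigma> B A\<close> cancels one of the two swaps of the hexagon. This
  is how \<open>hidden_obs_Suc\<close> undoes most of the reordering in
  \<open>pull_hidden\<close>.\<close>

lemma swap_tensor':
  assumes [simp]: "A \<in> Obj C" "B \<in> Obj C" "D \<in> Obj C"
  shows "\<sigma> A (B \<odot> D) \<cdot> \<alpha> A B D \<cdot> (\<sigma> B A \<otimes> \<one> D) \<cdot> \<alpha>_inv B A D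
    = \<alpha>_inv B D A \<cdot> (\<one> B \<otimes> \<sigma> A D)"
proof -
  have "\<sigma> A (B \<odot> D) \<cdot> \<alpha> A B D \<cdot> (\<sigma> B A \<otimes> \<one> D) \<cdot> \<alpha>_inv B A D
    = (\<sigma> A (B \<odot> D) \<cdot> \<alpha> A B D) \<cdot> (\<sigma> B A \<otimes> \<one> D) \<cdot> \<alpha>_inv B A D"
    by simp
  also have "\<dots> = \<alpha>_inv B D A \<cdot> (\<one> B \<otimes> \<sigma> A D)"
    by (subst swap_tensor) auto
  finally show ?thesis .
qed

lemma middle_swap_simps [simp]:
  assumes "A \<in> Obj C" "B \<in> Obj C" "D \<in> Obj C" "E \<in> Obj C"
  shows "middle_swap C A B D E \<in> Arr C" "Dom C (middle_swap C A B D E) = A \<odot> B \<odot> (D \<odot> E)"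
    "Cod C (middle_swap C A B D E) = A \<odot> D \<odot> (B \<odot> E)"
  using assms by (auto simp: middle_swap_def)

lemma middle_swap_nat:
  assumes [simp]: "a \<in> Arr C" "b \<in> Arr C" "d \<in> Arr C" "e \<in> Arr C"
    and [simp]: "Cod C a = A" "Cod C b = B" "Cod C d = D" "Cod C e = E"
  shows "middle_swap C A B D E \<cdot> (a \<otimes> b \<otimes> (d \<otimes> e))
    = (a \<otimes> d \<otimes> (b \<otimes> e)) \<cdot> middle_swap C (Dom C a) (Dom C b) (Dom C d) (Dom C e)"
proof -
  have [simp]: "A \<in> Obj C" "B \<in> Obj C" "D \<in> Obj C" "E \<in> Obj C"
    using cod_obj[OF assms(1)] cod_obj[OF assms(2)] cod_obj[OF assms(3)] cod_obj[OF assms(4)]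
    by simp_all
  \<comment> \<open>\<open>?m\<close> is the inner exchange of the second and third factor, which
    \<open>middle_swap\<close> wraps in associators.\<close>
  let ?m = "\<lambda>b d e. \<alpha> d b e \<cdot> (\<sigma> b d \<otimes> \<one> e) \<cdot> \<alpha>_inv b d e"
  have "?m B D E \<cdot> (b \<otimes> (d \<otimes> e))
      = \<alpha> D B E \<cdot> ((\<sigma> B D \<cdot> (b \<otimes> d)) \<otimes> e) \<cdot> \<alpha>_inv (Dom C b) (Dom C d) (Dom C e)"
    by (simp add: assoc_inv_nat)
  also have "\<dots> = (\<alpha> D B E \<cdot> (d \<otimes> b \<otimes> e)) \<cdot> (\<sigma> (Dom C b) (Dom C d) \<otimes> \<one> (Dom C e))
      \<cdot> \<alpha>_inv (Dom C b) (Dom C d) (Dom C e)"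
    by (simp add: swap_nat)
  also have "\<dots> = (d \<otimes> (b \<otimes> e)) \<cdot> ?m (Dom C b) (Dom C d) (Dom C e)"
    by (subst assoc_nat) auto
  finally have m: "?m B D E \<cdot> (b \<otimes> (d \<otimes> e)) = (d \<otimes> (b \<otimes> e)) \<cdot> ?m (Dom C b) (Dom C d) (Dom C e)" .
  have "middle_swap C A B D E \<cdot> (a \<otimes> b \<otimes> (d \<otimes> e))
    = \<alpha>_inv A D (B \<odot> E) \<cdot> (\<one> A \<otimes> ?m B D E) \<cdot> \<alpha> A B (D \<odot> E) \<cdot> (a \<otimes> b \<otimes> (d \<otimes> e))"
    by (simp add: middle_swap_def)
  also have "\<dots> = \<alpha>_inv A D (B \<odot> E) \<cdot> (a \<otimes> (?m B D E \<cdot> (b \<otimes> (d \<otimes> e))))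
      \<cdot> \<alpha> (Dom C a) (Dom C b) (Dom C d \<odot> Dom C e)"
    by (subst assoc_nat) auto
  also have "\<dots> = (\<alpha>_inv A D (B \<odot> E) \<cdot> (a \<otimes> (d \<otimes> (b \<otimes> e))))
      \<cdot> (\<one> (Dom C a) \<otimes> ?m (Dom C b) (Dom C d) (Dom C e))
          \<cdot> \<alpha> (Dom C a) (Dom C b) (Dom C d \<odot> Dom C e)"
    unfolding m by simp
  also have "\<dots> = (a \<otimes> d \<otimes> (b \<otimes> e)) \<cdot> middle_swap C (Dom C a) (Dom C b) (Dom C d) (Dom C e)"
    by (subst assoc_inv_nat) (auto simp: middle_swap_def)
  finally show ?thesis .
qed

text \<open>Moving \<open>A\<close> past \<open>B \<odot> D\<close> means moving it past
  \<open>B\<close> and then past \<open>D\<close>, by the hexagon; the second move is the middle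
  swap. \<open>filter_step\<close> uses this to recognise copying on a tensor product.\<close>

lemma swap_tensor_middle_swap:
  assumes [simp]: "A \<in> Obj C" "B \<in> Obj C" "D \<in> Obj C" "E \<in> Obj C"
  shows "\<alpha> (B \<odot> D) A E \<cdot> (\<sigma> A (B \<odot> D) \<otimes> \<one> E) \<cdot> \<alpha>_inv A (B \<odot> D) E
      \<cdot> (\<one> A \<otimes> \<alpha>_inv B D E) \<cdot> \<alpha> A B (D \<odot> E)
    = middle_swap C B A D E \<cdot> (\<sigma> A B \<otimes> \<one> (D \<odot> E))"
proof -
  have "\<alpha> (B \<odot> D) A E \<cdot> (\<sigma> A (B \<odot> D) \<otimes> \<one> E) \<cdot> \<alpha>_inv A (B \<odot> D) E
      \<cdot> (\<one> A \<otimes> \<alpha>_inv B D E) \<cdot> \<alpha> A B (D \<odot> E)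
    = \<alpha> (B \<odot> D) A E \<cdot> ((\<sigma> A (B \<odot> D) \<cdot> \<alpha> A B D) \<otimes> \<one> E) \<cdot> \<alpha>_inv (A \<odot> B) D E"
    by (subst pentagon_inv) auto
  also have "\<dots> = (\<alpha> (B \<odot> D) A E \<cdot> (\<alpha>_inv B D A \<otimes> \<one> E)) \<cdot> (\<one> B \<otimes> \<sigma> A D \<otimes> \<one> E)
      \<cdot> (\<alpha> B A D \<otimes> \<one> E) \<cdot> (\<sigma> A B \<otimes> \<one> D \<otimes> \<one> E) \<cdot> \<alpha>_inv (A \<odot> B) D E"
    by (subst swap_tensor) auto
  also have "\<dots> = \<alpha>_inv B D (A \<odot> E) \<cdot> (\<one> B \<otimes> \<alpha> D A E) \<cdot> (\<alpha> B (D \<odot> A) E \<cdot> (\<one> B \<otimes> \<sigma> A D \<otimes> \<one> E))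
      \<cdot> (\<alpha> B A D \<otimes> \<one> E) \<cdot> (\<sigma> A B \<otimes> \<one> D \<otimes> \<one> E) \<cdot> \<alpha>_inv (A \<odot> B) D E"
    by (subst pentagon_inv'[symmetric]) auto
  also have "(\<sigma> A B \<otimes> \<one> D \<otimes> \<one> E) \<cdot> \<alpha>_inv (A \<odot> B) D E
      = \<alpha>_inv (B \<odot> A) D E \<cdot> (\<sigma> A B \<otimes> (\<one> D \<otimes> \<one> E))"
    by (subst assoc_inv_nat) auto
  also have "\<alpha> B (D \<odot> A) E \<cdot> (\<one> B \<otimes> \<sigma> A D \<otimes> \<one> E) = (\<one> B \<otimes> (\<sigma> A D \<otimes> \<one> E)) \<cdot> \<alpha> B (A \<odot> D) E"
    by (subst assoc_nat) auto
  also have "(\<alpha> B A D \<otimes> \<one> E) \<cdot> \<alpha>_inv (B \<odot> A) D E \<cdot> (\<sigma> A B \<otimes> (\<one> D \<otimes> \<one> E))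
     = (\<alpha>_inv B (A \<odot> D) E \<cdot> (\<one> B \<otimes> \<alpha>_inv A D E) \<cdot> \<alpha> B A (D \<odot> E)) \<cdot> (\<sigma> A B \<otimes> (\<one> D \<otimes> \<one> E))"
    by (subst pentagon_inv) auto
  finally show ?thesis
    by (simp add: middle_swap_def)
qed

end

section \<open>Marginals, determinism and conditionals\<close>

context markov_category
begin

lemma copy_del_simps [simp]:
  assumes "A \<in> Obj C"
  shows "\<Delta> A \<in> Arr C" "Dom C (\<Delta> A) = A" "Cod C (\<Delta> A) = A \<odot> A"
    "\<epsilon> A \<in> Arr C" "Dom C (\<epsilon> A) = A" "Cod C (\<epsilon> A) = \<I>"
  using copy_hom del_hom assms by (auto simp: in_hom_def)

lemma del_unique:
  assumes "f \<in> Arr C" "Cod C f = \<I>"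
  shows "f = \<epsilon> (Dom C f)"
  using unit_terminal[of f "Dom C f"] assms by (simp add: in_hom_def)

lemma del_comp [simp]:
  assumes "f \<in> Arr C" "Cod C f = A"
  shows "\<epsilon> A \<cdot> f = \<epsilon> (Dom C f)"
proof -
  have "A \<in> Obj C"
    using assms by auto
  then show ?thesis
    using assms del_unique[of "\<epsilon> A \<cdot> f"] by simp
qed

lemma proj_simps [simp]:
  assumes "A \<in> Obj C" "B \<in> Obj C"
  shows "proj_left C A B \<in> Arr C" "Dom C (proj_left C A B) = A \<odot> B" "Cod C (proj_left C A B) = A"
    "proj_right C A B \<in> Arr C" "Dom C (proj_right C A B) = A \<odot> B" "Cod C (proj_right C A B) = B"
  using assms by (auto simp: proj_left_def proj_right_def)

text \<open>Terminality of the unit enters here: \<open>g\<close> vanishes because deleting after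
  \<open>g\<close> is the same as deleting its input.\<close>

lemma proj_left_nat:
  assumes "f \<in> Arr C" "g \<in> Arr C" "Cod C f = A" "Cod C g = B"
  shows "proj_left C A B \<cdot> (f \<otimes> g) = f \<cdot> proj_left C (Dom C f) (Dom C g)"
proof -
  have [simp]: "A \<in> Obj C" "B \<in> Obj C"
    using assms by auto
  have "proj_left C A B \<cdot> (f \<otimes> g) = (\<rho> A \<cdot> (f \<otimes> \<one> \<I>)) \<cdot> (\<one> (Dom C f) \<otimes> \<epsilon> (Dom C g))"
    using assms by (simp add: proj_left_def)
  also have "\<dots> = f \<cdot> proj_left C (Dom C f) (Dom C g)"
    using assms by (subst runit_natural[of f "Dom C f" A]) (auto simp: proj_left_def in_hom_def)
  finally show ?thesis .
qed

lemma proj_right_nat: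
  assumes "f \<in> Arr C" "g \<in> Arr C" "Cod C f = A" "Cod C g = B"
  shows "proj_right C A B \<cdot> (f \<otimes> g) = g \<cdot> proj_right C (Dom C f) (Dom C g)"
proof -
  have [simp]: "A \<in> Obj C" "B \<in> Obj C"
    using assms by auto
  have "proj_right C A B \<cdot> (f \<otimes> g) = (\<ell> B \<cdot> (\<one> \<I> \<otimes> g)) \<cdot> (\<epsilon> (Dom C f) \<otimes> \<one> (Dom C g))"
    using assms by (simp add: proj_right_def)
  also have "\<dots> = g \<cdot> proj_right C (Dom C f) (Dom C g)"
    using assms by (subst lunit_natural[of g "Dom C g" B]) (auto simp: proj_right_def in_hom_def)
  finally show ?thesis .
qed

lemma proj_left_nat_comp:
  assumes "f \<in> Arr C" "g \<in> Arr C" "Cod C f = A" "Cod C g = B" "r \<in> Arr C" "Cod C r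
      = Dom C f \<odot> Dom C g"
  shows "proj_left C A B \<cdot> (f \<otimes> g) \<cdot> r = f \<cdot> proj_left C (Dom C f) (Dom C g) \<cdot> r"
  using assms comp_reassoc[OF proj_left_nat[OF assms(1-4)] _ _ _ assms(5)] by fastforce

lemma proj_right_nat_comp:
  assumes "f \<in> Arr C" "g \<in> Arr C" "Cod C f = A" "Cod C g = B" "r \<in> Arr C" "Cod C r
      = Dom C f \<odot> Dom C g"
  shows "proj_right C A B \<cdot> (f \<otimes> g) \<cdot> r = g \<cdot> proj_right C (Dom C f) (Dom C g) \<cdot> r"
  using assms comp_reassoc[OF proj_right_nat[OF assms(1-4)] _ _ _ assms(5)] by fastforce

lemma proj_copy [simp]:
  assumes "A \<in> Obj C"
  shows "proj_left C A A \<cdot> \<Delta> A = \<one> A" "proj_right C A A \<cdot> \<Delta> A = \<one> A"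
  using assms copy_counit_left[OF assms] copy_counit_right[OF assms]
  by (simp_all add: proj_left_def proj_right_def)

lemma proj_copy_comp [simp]:
  assumes "A \<in> Obj C" "r \<in> Arr C" "Cod C r = A"
  shows "proj_left C A A \<cdot> \<Delta> A \<cdot> r = r" "proj_right C A A \<cdot> \<Delta> A \<cdot> r = r"
  using assms by (simp_all add: assoc_comp[symmetric] del: assoc_comp)

lemma proj_left_assoc_inv:
  assumes [simp]: "A \<in> Obj C" "B \<in> Obj C" "D \<in> Obj C"
  shows "proj_left C (A \<odot> B) D \<cdot> \<alpha>_inv A B D = \<one> A \<otimes> proj_left C B D"
proof -
  have "proj_left C (A \<odot> B) D \<cdot> \<alpha>_inv A B D
    = \<rho> (A \<odot> B) \<cdot> (\<one> A \<otimes> \<one> B \<otimes> \<epsilon> D) \<cdot> \<alpha>_inv A B D"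
    by (simp add: proj_left_def)
  also have "\<dots> = (\<rho> (A \<odot> B) \<cdot> \<alpha>_inv A B \<I>) \<cdot> (\<one> A \<otimes> (\<one> B \<otimes> \<epsilon> D))"
    using assoc_inv_nat[of "\<one> A" "\<one> B" "\<epsilon> D" A B \<I>] by simp
  also have "\<dots> = \<one> A \<otimes> proj_left C B D"
    by (subst runit_tensor_inv) (auto simp: proj_left_def)
  finally show ?thesis .
qed

text \<open>The deletion of \<open>A\<close> is pushed through the associators and the swap; then
  \<open>lunit_swap\<close> turns \<open>\<ell>\<close> into \<open>\<rho>\<close>, and the triangle
  removes the remaining associator.\<close>

lemma proj_right_swap:
  assumes [simp]: "A \<in> Obj C" "B \<in> Obj C" "D \<in> Obj C"
  shows "proj_right C A (B \<odot> D) \<cdot> \<alpha> A B D \<cdot> (\<sigma> B A \<otimes> \<one> D) \<cdot> \<alpha>_inv B A D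
    = \<one> B \<otimes> proj_right C A D"
proof -
  have "proj_right C A (B \<odot> D) \<cdot> \<alpha> A B D \<cdot> (\<sigma> B A \<otimes> \<one> D) \<cdot> \<alpha>_inv B A D
    = \<ell> (B \<odot> D) \<cdot> ((\<epsilon> A \<otimes> (\<one> B \<otimes> \<one> D)) \<cdot> \<alpha> A B D) \<cdot> (\<sigma> B A \<otimes> \<one> D) \<cdot> \<alpha>_inv B A D"
    by (simp add: proj_right_def)
  also have "\<dots> = \<ell> (B \<odot> D) \<cdot> (\<alpha> \<I> B D \<cdot> (\<epsilon> A \<otimes> \<one> B \<otimes> \<one> D)) \<cdot> (\<sigma> B A \<otimes> \<one> D) \<cdot> \<alpha>_inv B A D"
    by (subst assoc_nat) auto
  also have "\<dots> = (\<ell> (B \<odot> D) \<cdot> \<alpha> \<I> B D) \<cdot> (((\<epsilon> A \<otimes> \<one> B) \<cdot> \<sigma> B A) \<otimes> \<one> D) \<cdot> \<alpha>_inv B A D"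
    by simp
  also have "\<dots> = (\<ell> B \<otimes> \<one> D) \<cdot> ((\<sigma> B \<I> \<cdot> (\<one> B \<otimes> \<epsilon> A)) \<otimes> \<one> D) \<cdot> \<alpha>_inv B A D"
    by (simp add: lunit_tensor swap_nat)
  also have "\<dots> = ((\<ell> B \<cdot> \<sigma> B \<I>) \<otimes> \<one> D) \<cdot> (\<one> B \<otimes> \<epsilon> A \<otimes> \<one> D) \<cdot> \<alpha>_inv B A D"
    by simp
  also have "\<dots> = (\<rho> B \<otimes> \<one> D) \<cdot> \<alpha>_inv B \<I> D \<cdot> (\<one> B \<otimes> (\<epsilon> A \<otimes> \<one> D))"
    by (simp add: lunit_swap assoc_inv_nat del: interchange interchange_comp)
  also have "\<dots> = ((\<rho> B \<otimes> \<one> D) \<cdot> \<alpha>_inv B \<I> D) \<cdot> (\<one> B \<otimes> (\<epsilon> A \<otimes> \<one> D))"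
    by simp
  also have "\<dots> = \<one> B \<otimes> proj_right C A D"
    by (subst triangle_inv) (auto simp: proj_right_def)
  finally show ?thesis .
qed

section \<open>Deterministic morphisms, almost sure equality and conditionals\<close>

lemma deterministic_comp:
  assumes "deterministic C f" "deterministic C g" "Cod C f = Dom C g"
  shows "deterministic C (g \<cdot> f)"
proof -
  have [simp]: "f \<in> Arr C" "g \<in> Arr C"
    using assms by (auto simp: deterministic_def)
  have "\<Delta> (Cod C g) \<cdot> g \<cdot> f = (\<Delta> (Cod C g) \<cdot> g) \<cdot> f"
    using assms(3) by simp
  also have "\<dots> = (g \<otimes> g) \<cdot> \<Delta> (Cod C f) \<cdot> f"
    using assms by (simp add: deterministic_def)
  also have "\<dots> = ((g \<cdot> f) \<otimes> (g \<cdot> f)) \<cdot> \<Delta> (Dom C f)"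
    using assms by (simp add: deterministic_def)
  finally show ?thesis
    using assms(3) by (simp add: deterministic_def)
qed

text \<open>Copying a tensor product is componentwise copying followed by a middle swap, and the
  middle swap is natural.\<close>

lemma deterministic_tensor:
  assumes "deterministic C f" "deterministic C g"
  shows "deterministic C (f \<otimes> g)"
proof -
  have [simp]: "f \<in> Arr C" "g \<in> Arr C"
    and c: "\<Delta> (Cod C f) \<cdot> f = (f \<otimes> f) \<cdot> \<Delta> (Dom C f)" "\<Delta> (Cod C g) \<cdot> g = (g \<otimes> g) \<cdot> \<Delta> (Dom C g)"
    using assms by (auto simp: deterministic_def)
  have "\<Delta> (Cod C f \<odot> Cod C g) \<cdot> (f \<otimes> g)
    = middle_swap C (Cod C f) (Cod C f) (Cod C g) (Cod C g) \<cdot> (f \<otimes> f \<otimes> (g \<otimes> g))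
        \<cdot> (\<Delta> (Dom C f) \<otimes> \<Delta> (Dom C g))"
    by (simp add: copy_tensor c)
  also have "\<dots> = (middle_swap C (Cod C f) (Cod C f) (Cod C g) (Cod C g) \<cdot> (f \<otimes> f \<otimes> (g \<otimes> g)))
      \<cdot> (\<Delta> (Dom C f) \<otimes> \<Delta> (Dom C g))"
    by simp
  also have "\<dots> = (f \<otimes> g \<otimes> (f \<otimes> g)) \<cdot> \<Delta> (Dom C f \<odot> Dom C g)"
    by (subst middle_swap_nat) (auto simp: copy_tensor)
  finally show ?thesis
    by (simp add: deterministic_def)
qed

lemma deterministic_ident:
  assumes "A \<in> Obj C"
  shows "deterministic C (\<one> A)"
  using assms by (simp add: deterministic_def)

text \<open>\<open>as_eq\<close> applies the morphisms to the second copy, whereas conditionals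
  produce their output on the left. Commutativity of copying reconciles the two.\<close>

lemma as_eqI:
  assumes "q \<in> Arr C" "\<guillemotleft>a : A \<rightarrow> B\<guillemotright>" "\<guillemotleft>b : A \<rightarrow> B\<guillemotright>" "Cod C q = A"
    and eq: "(a \<otimes> \<one> A) \<cdot> \<Delta> A \<cdot> q = (b \<otimes> \<one> A) \<cdot> \<Delta> A \<cdot> q"
  shows "as_eq C q a b"
proof -
  note [simp] = in_homD[OF assms(2)] in_homD[OF assms(3)] assms(1,4)
  have "(\<one> A \<otimes> c) \<cdot> \<Delta> A \<cdot> q = \<sigma> B A \<cdot> (c \<otimes> \<one> A) \<cdot> \<Delta> A \<cdot> q" if c [simp]: "c \<in> Arr C" "Dom C c
      = A" "Cod C c = B" for c
  proof -
    have "\<sigma> B A \<cdot> (c \<otimes> \<one> A) \<cdot> \<Delta> A \<cdot> q = (\<one> A \<otimes> c) \<cdot> (\<sigma> A A \<cdot> \<Delta> A) \<cdot> q"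
      by (simp add: swap_nat_comp)
    then show ?thesis
      by (simp add: copy_comm)
  qed
  then have "(\<one> A \<otimes> a) \<cdot> \<Delta> A \<cdot> q = (\<one> A \<otimes> b) \<cdot> \<Delta> A \<cdot> q"
    using eq by simp
  then show ?thesis
    unfolding as_eq_def using assms by (auto simp: in_hom_def)
qed

lemma as_eqD:
  assumes "as_eq C q a b"
  shows "(\<one> (Cod C q) \<otimes> a) \<cdot> \<Delta> (Cod C q) \<cdot> q = (\<one> (Cod C q) \<otimes> b) \<cdot> \<Delta> (Cod C q) \<cdot> q"
  using assms by (auto simp: as_eq_def in_hom_def)

lemma as_eq_sym: "as_eq C q a b \<Longrightarrow> as_eq C q b a"
  unfolding as_eq_def by metis

text \<open>Since \<open>w\<close> is deterministic, copying its output amounts to copying its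
  input: one \<open>w\<close> then precedes the marginal of \<open>c\<close>, the other the
  conditional \<open>h\<close>.\<close>

lemma conditional_precomp:
  assumes cond: "is_conditional C A X Y c h" and w: "\<guillemotleft>w : Z \<rightarrow> A\<guillemotright>" "deterministic C w"
    and [simp]: "Y \<in> Obj C"
  shows "is_conditional C Z X Y (c \<cdot> w) (h \<cdot> (w \<otimes> \<one> Y))"
proof -
  have c: "\<guillemotleft>c : A \<rightarrow> X \<odot> Y\<guillemotright>" and h: "\<guillemotleft>h : A \<odot> Y \<rightarrow> X\<guillemotright>"
    and eq: "c = (h \<otimes> \<one> Y) \<cdot> \<alpha>_inv A Y Y \<cdot> (\<one> A \<otimes> \<Delta> Y) \<cdot> (\<one> A \<otimes> (proj_right C X Y \<cdot> c)) \<cdot> \<Delta> A"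
    using cond by (auto simp: is_conditional_def)
  note [simp] = in_homD[OF c] in_homD[OF h] in_homD[OF w(1)]
  have "c \<cdot> w = (h \<otimes> \<one> Y) \<cdot> \<alpha>_inv A Y Y \<cdot> (\<one> A \<otimes> \<Delta> Y) \<cdot> (\<one> A \<otimes> (proj_right C X Y \<cdot> c)) \<cdot> \<Delta> A \<cdot> w"
    by (subst eq) simp
  also have "\<Delta> A \<cdot> w = (w \<otimes> w) \<cdot> \<Delta> Z"
    using w(2) by (simp add: deterministic_def)
  also have "(h \<otimes> \<one> Y) \<cdot> \<alpha>_inv A Y Y \<cdot> (\<one> A \<otimes> \<Delta> Y) \<cdot> (\<one> A \<otimes> (proj_right C X Y \<cdot> c)) \<cdot> (w \<otimes> w) \<cdot> \<Delta> Z
    = (h \<otimes> \<one> Y) \<cdot> (\<alpha>_inv A Y Y \<cdot> (w \<otimes> (\<one> Y \<otimes> \<one> Y))) \<cdot> (\<one> Z \<otimes> (\<Delta> Y \<cdot> proj_right C X Y \<cdot> c \<cdot> w))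
        \<cdot> \<Delta> Z"
    by simp
  also have "\<alpha>_inv A Y Y \<cdot> (w \<otimes> (\<one> Y \<otimes> \<one> Y)) = (w \<otimes> \<one> Y \<otimes> \<one> Y) \<cdot> \<alpha>_inv Z Y Y"
    by (subst assoc_inv_nat) auto
  finally show ?thesis
    by (simp add: is_conditional_def in_hom_def)
qed

text \<open>For a state the input to be copied is \<open>\<I>\<close>, so the defining equation
  loses its unitors and becomes a disintegration along \<open>Z\<close>.\<close>

lemma conditional_of_state:
  assumes cond: "is_conditional C \<I> X Z j (b \<cdot> \<ell> Z)" and b: "\<guillemotleft>b : Z \<rightarrow> X\<guillemotright>"
  shows "j = (b \<otimes> \<one> Z) \<cdot> \<Delta> Z \<cdot> proj_right C X Z \<cdot> j"
proof -
  have j: "\<guillemotleft>j : \<I> \<rightarrow> X \<odot> Z\<guillemotright>"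
    and eq: "j = ((b \<cdot> \<ell> Z) \<otimes> \<one> Z) \<cdot> \<alpha>_inv \<I> Z Z \<cdot> (\<one> \<I> \<otimes> \<Delta> Z) \<cdot> (\<one> \<I> \<otimes> (proj_right C X Z \<cdot> j))
        \<cdot> \<Delta> \<I>"
    using cond by (auto simp: is_conditional_def)
  note [simp] = in_homD[OF j] in_homD[OF b]
  let ?k = "\<Delta> Z \<cdot> proj_right C X Z \<cdot> j"
  \<comment> \<open>Both sides are endomorphisms of the terminal object.\<close>
  have unit: "\<ell> \<I> \<cdot> \<Delta> \<I> = \<one> \<I>"
    using del_unique[of "\<ell> \<I> \<cdot> \<Delta> \<I>"] del_unique[of "\<one> \<I>"] by simp
  have k: "\<guillemotleft>?k : \<I> \<rightarrow> Z \<odot> Z\<guillemotright>"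
    by (simp add: in_hom_def)
  note eq
  also have "((b \<cdot> \<ell> Z) \<otimes> \<one> Z) \<cdot> \<alpha>_inv \<I> Z Z \<cdot> (\<one> \<I> \<otimes> \<Delta> Z) \<cdot> (\<one> \<I> \<otimes> (proj_right C X Z \<cdot> j)) \<cdot> \<Delta> \<I>
    = (b \<otimes> \<one> Z) \<cdot> (\<ell> Z \<otimes> \<one> Z) \<cdot> \<alpha>_inv \<I> Z Z \<cdot> (\<one> \<I> \<otimes> ?k) \<cdot> \<Delta> \<I>"
    by simp
  also have "\<dots> = (b \<otimes> \<one> Z) \<cdot> (\<ell> (Z \<odot> Z) \<cdot> \<alpha> \<I> Z Z) \<cdot> \<alpha>_inv \<I> Z Z \<cdot> (\<one> \<I> \<otimes> ?k) \<cdot> \<Delta> \<I>"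
    by (subst lunit_tensor) auto
  also have "\<dots> = (b \<otimes> \<one> Z) \<cdot> (\<ell> (Z \<odot> Z) \<cdot> (\<one> \<I> \<otimes> ?k)) \<cdot> \<Delta> \<I>"
    by simp
  also have "\<dots> = (b \<otimes> \<one> Z) \<cdot> ?k \<cdot> \<ell> \<I> \<cdot> \<Delta> \<I>"
    by (subst lunit_natural[OF k]) auto
  finally show ?thesis
    by (simp add: unit)
qed

text \<open>A conditional given only \<open>Y\<close>, with parameter \<open>Z\<close>, becomes a
  conditional given the pair: \<open>v\<close> may equally well read a copy of
  \<open>Z \<odot> Y\<close> made after \<open>h\<close> has produced \<open>Y\<close>. The prefix
  moves \<open>X\<close> to the front, as \<open>pull_hidden\<close> does.\<close>

lemma filter_step:
  assumes v: "\<guillemotleft>v : Z \<odot> Y \<rightarrow> X\<guillemotright>" and h: "\<guillemotleft>h : Z \<rightarrow> Y\<guillemotright>"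
  shows "\<alpha> X Z Y \<cdot> (\<sigma> Z X \<otimes> \<one> Y) \<cdot> \<alpha>_inv Z X Y
      \<cdot> (\<one> Z \<otimes> ((v \<otimes> \<one> Y) \<cdot> \<alpha>_inv Z Y Y \<cdot> (\<one> Z \<otimes> \<Delta> Y) \<cdot> (\<one> Z \<otimes> h) \<cdot> \<Delta> Z)) \<cdot> \<Delta> Z
    = (v \<otimes> \<one> (Z \<odot> Y)) \<cdot> \<Delta> (Z \<odot> Y) \<cdot> (\<one> Z \<otimes> h) \<cdot> \<Delta> Z"
proof -
  note [simp] = in_homD(1-3)[OF v] in_homD[OF h] in_homD(5)[OF v]
  let ?a = "(\<one> Z \<otimes> \<alpha>_inv Z Y Y) \<cdot> \<alpha> Z Z (Y \<odot> Y)"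
  have "\<alpha> X Z Y \<cdot> (\<sigma> Z X \<otimes> \<one> Y) \<cdot> \<alpha>_inv Z X Y
      \<cdot> (\<one> Z \<otimes> ((v \<otimes> \<one> Y) \<cdot> \<alpha>_inv Z Y Y \<cdot> (\<one> Z \<otimes> \<Delta> Y) \<cdot> (\<one> Z \<otimes> h) \<cdot> \<Delta> Z)) \<cdot> \<Delta> Z
    = \<alpha> X Z Y \<cdot> (\<sigma> Z X \<otimes> \<one> Y) \<cdot> \<alpha>_inv Z X Y
      \<cdot> (\<one> Z \<otimes> (v \<otimes> \<one> Y)) \<cdot> (\<one> Z \<otimes> \<alpha>_inv Z Y Y) \<cdot> (\<one> Z \<otimes> (\<one> Z \<otimes> (\<Delta> Y \<cdot> h))) \<cdot> ((\<one> Z \<otimes> \<Delta> Z) \<cdot> \<Delta> Z)"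
    by simp
  \<comment> \<open>Coassociativity groups the kept copy of \<open>Z\<close> with the one read by
    \<open>v\<close>; the third copy feeds \<open>h\<close>.\<close>
  also have "\<dots> = \<alpha> X Z Y \<cdot> (\<sigma> Z X \<otimes> \<one> Y) \<cdot> (\<alpha>_inv Z X Y
      \<cdot> (\<one> Z \<otimes> (v \<otimes> \<one> Y))) \<cdot> (\<one> Z \<otimes> \<alpha>_inv Z Y Y) \<cdot> ((\<one> Z \<otimes> (\<one> Z \<otimes> (\<Delta> Y \<cdot> h))) \<cdot> \<alpha> Z Z Z)
          \<cdot> (\<Delta> Z \<otimes> \<one> Z) \<cdot> \<Delta> Z"
    by (subst copy_assoc[symmetric]) auto
  also have "(\<one> Z \<otimes> (\<one> Z \<otimes> (\<Delta> Y \<cdot> h))) \<cdot> \<alpha> Z Z Z = \<alpha> Z Z (Y \<odot> Y) \<cdot> (\<one> Z \<otimes> \<one> Z \<otimes> (\<Delta> Y \<cdot> h))"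
    by (subst assoc_nat) auto
  also have "\<alpha>_inv Z X Y \<cdot> (\<one> Z \<otimes> (v \<otimes> \<one> Y)) = (\<one> Z \<otimes> v \<otimes> \<one> Y) \<cdot> \<alpha>_inv Z (Z \<odot> Y) Y"
    by (subst assoc_inv_nat) auto
  also have "\<alpha> X Z Y \<cdot> (\<sigma> Z X \<otimes> \<one> Y) \<cdot> ((\<one> Z \<otimes> v \<otimes> \<one> Y) \<cdot> \<alpha>_inv Z (Z \<odot> Y) Y)
      \<cdot> (\<one> Z \<otimes> \<alpha>_inv Z Y Y) \<cdot> (\<alpha> Z Z (Y \<odot> Y) \<cdot> (\<one> Z \<otimes> \<one> Z \<otimes> (\<Delta> Y \<cdot> h))) \<cdot> (\<Delta> Z \<otimes> \<one> Z) \<cdot> \<Delta> Z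
    = (\<alpha> X Z Y \<cdot> (v \<otimes> \<one> Z \<otimes> \<one> Y)) \<cdot> (\<sigma> Z (Z \<odot> Y) \<otimes> \<one> Y) \<cdot> \<alpha>_inv Z (Z \<odot> Y) Y
      \<cdot> ?a \<cdot> (\<Delta> Z \<otimes> \<Delta> Y) \<cdot> (\<one> Z \<otimes> h) \<cdot> \<Delta> Z"
    by (simp add: swap_nat)
  also have "\<alpha> X Z Y \<cdot> (v \<otimes> \<one> Z \<otimes> \<one> Y) = (v \<otimes> \<one> (Z \<odot> Y)) \<cdot> \<alpha> (Z \<odot> Y) Z Y"
    by (subst assoc_nat) auto
  also have "((v \<otimes> \<one> (Z \<odot> Y)) \<cdot> \<alpha> (Z \<odot> Y) Z Y) \<cdot> (\<sigma> Z (Z \<odot> Y) \<otimes> \<one> Y) \<cdot> \<alpha>_inv Z (Z \<odot> Y) Y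
      \<cdot> ?a \<cdot> (\<Delta> Z \<otimes> \<Delta> Y) \<cdot> (\<one> Z \<otimes> h) \<cdot> \<Delta> Z
    = (v \<otimes> \<one> (Z \<odot> Y)) \<cdot> (\<alpha> (Z \<odot> Y) Z Y \<cdot> (\<sigma> Z (Z \<odot> Y) \<otimes> \<one> Y) \<cdot> \<alpha>_inv Z (Z \<odot> Y) Y \<cdot> ?a)
      \<cdot> (\<Delta> Z \<otimes> \<Delta> Y) \<cdot> (\<one> Z \<otimes> h) \<cdot> \<Delta> Z"
    by simp
  \<comment> \<open>Both swapped objects are \<open>Z\<close>, so the leftover swap is absorbed by
    \<open>copy_comm\<close>, and the middle swap assembles
    \<open>\<Delta> (Z \<odot> Y)\<close>.\<close>
  also have "\<dots> = (v \<otimes> \<one> (Z \<odot> Y)) \<cdot> \<Delta> (Z \<odot> Y) \<cdot> (\<one> Z \<otimes> h) \<cdot> \<Delta> Z"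
    by (subst swap_tensor_middle_swap) (auto simp: copy_comm copy_tensor)
  finally show ?thesis .
qed

end

section \<open>Finite tensor products and iterated updates\<close>

context monoidal_category
begin

lemma tens_obj_in [simp]: "(\<And>i. i \<le> t \<Longrightarrow> F i \<in> Obj C) \<Longrightarrow> tens_obj C F t \<in> Obj C"
  by (induction t) auto

lemma tens_mor_hom:
  assumes "\<And>i. i \<le> t \<Longrightarrow> \<guillemotleft>h i : F i \<rightarrow> G i\<guillemotright>"
  shows "\<guillemotleft>tens_mor C h t : tens_obj C F t \<rightarrow> tens_obj C G t\<guillemotright>"
  using assms by (induction t) (auto intro: tensor_hom)

lemma tens_mor_comp:
  assumes "\<And>i. i \<le> t \<Longrightarrow> h i \<in> Arr C" "\<And>i. i \<le> t \<Longrightarrow> k i \<in> Arr C"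
    "\<And>i. i \<le> t \<Longrightarrow> Cod C (h i) = Dom C (k i)"
  shows "tens_mor C (\<lambda>i. k i \<cdot> h i) t = tens_mor C k t \<cdot> tens_mor C h t"
  using assms
proof (induction t)
  case (Suc t)
  have h: "\<guillemotleft>tens_mor C h t : tens_obj C (\<lambda>i. Dom C (h i)) t \<rightarrow> tens_obj C (\<lambda>i. Cod C (h i)) t\<guillemotright>"
    using Suc.prems by (intro tens_mor_hom) (auto simp: in_hom_def)
  have k: "\<guillemotleft>tens_mor C k t : tens_obj C (\<lambda>i. Cod C (h i)) t \<rightarrow> tens_obj C (\<lambda>i. Cod C (k i)) t\<guillemotright>"
    using Suc.prems by (intro tens_mor_hom) (auto simp: in_hom_def)
  show ?case
    using Suc in_homD(1-3)[OF h] in_homD(1-3)[OF k] by simp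
qed simp

section \<open>Composites of padded stages\<close>

lemma comp_seq_hom:
  assumes "\<And>s. s \<le> t \<Longrightarrow> \<guillemotleft>h s : Q s \<rightarrow> Q (Suc s)\<guillemotright>"
  shows "\<guillemotleft>comp_seq C h t : Q 0 \<rightarrow> Q (Suc t)\<guillemotright>"
  using assms by (induction t) (auto intro: comp_hom)

lemma comp_seq_tensor:
  assumes "\<And>s. s \<le> t \<Longrightarrow> \<guillemotleft>h s : Q s \<rightarrow> Q (Suc s)\<guillemotright>" "A \<in> Obj C"
  shows "comp_seq C (\<lambda>s. h s \<otimes> \<one> A) t = comp_seq C h t \<otimes> \<one> A"
  using assms(1)
proof (induction t)
  case (Suc t)
  have "\<guillemotleft>comp_seq C h t : Q 0 \<rightarrow> Q (Suc t)\<guillemotright>"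
    using Suc.prems by (intro comp_seq_hom) auto
  moreover have "\<guillemotleft>h (Suc t) : Q (Suc t) \<rightarrow> Q (Suc (Suc t))\<guillemotright>"
    using Suc.prems by blast
  ultimately show ?case
    using Suc assms(2) by (simp add: in_hom_def)
qed simp

text \<open>The index \<open>s\<close> itself is included, unlike in \<open>pad_right\<close>; hence
  the \<open>Suc s\<close> in \<open>pad_right_hom\<close>. The range is empty for
  \<open>s = Suc t\<close>.\<close>

definition pad_obj :: "(nat \<Rightarrow> 'a) \<Rightarrow> 'a \<Rightarrow> nat \<Rightarrow> nat \<Rightarrow> 'a"
  where "pad_obj Y A s t = foldl (\<lambda>K i. K \<odot> Y i) A [s..<Suc t]"

lemma pad_obj_Suc: "s \<le> Suc t \<Longrightarrow> pad_obj Y A s (Suc t) = pad_obj Y A s t \<odot> Y (Suc t)"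
  by (simp add: pad_obj_def)

lemma pad_right_Suc:
  assumes "s \<le> t"
  shows "pad_right C Y h s (Suc t) = pad_right C Y h s t \<otimes> \<one> (Y (Suc t))"
  using assms by (simp add: pad_right_def)

lemma pad_right_hom:
  assumes "\<guillemotleft>h : A \<rightarrow> B\<guillemotright>" "\<And>i. i \<le> t \<Longrightarrow> Y i \<in> Obj C" "s \<le> t"
  shows "\<guillemotleft>pad_right C Y h s t : pad_obj Y A (Suc s) t \<rightarrow> pad_obj Y B (Suc s) t\<guillemotright>"
  using assms(3,2)
proof (induction t rule: dec_induct)
  case base
  then show ?case
    using assms(1) by (simp add: pad_right_def pad_obj_def)
next
  case (step t)
  then show ?case
    by (auto simp: pad_right_Suc pad_obj_Suc intro: tensor_hom ident_hom)
qed

text \<open>Lengthening the horizon tensors each of the stages up to \<open>t\<close> with the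
  identity of the new observation, while the new last stage is unpadded.\<close>

lemma iterated_update_Suc:
  assumes v0: "\<guillemotleft>v 0 : Y 0 \<rightarrow> B 0\<guillemotright>"
    and v: "\<And>s. s < t \<Longrightarrow> \<guillemotleft>v (Suc s) : B s \<odot> Y (Suc s) \<rightarrow> B (Suc s)\<guillemotright>"
    and Y: "\<And>i. i \<le> Suc t \<Longrightarrow> Y i \<in> Obj C"
  shows "iterated_update C Y v (Suc t) = v (Suc t) \<cdot> (iterated_update C Y v t \<otimes> \<one> (Y (Suc t)))"
proof -
  \<comment> \<open>\<open>Q s\<close> is the object entering stage \<open>s\<close>.
    \<open>Q 0\<close> starts with \<open>Y 0\<close> alone because \<open>v 0\<close> takes no
    previous state.\<close>
  define Q where "Q s = (case s of 0 \<Rightarrow> pad_obj Y (Y 0) 1 t | Suc r \<Rightarrow> pad_obj Y (B r) (Suc r) t)" for s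
  have Q: "\<guillemotleft>pad_right C Y (v s) s t : Q s \<rightarrow> Q (Suc s)\<guillemotright>" if "s \<le> t" for s
  proof (cases s)
    case 0
    then show ?thesis
      using pad_right_hom[OF v0, of t Y 0] Y that by (simp add: Q_def)
  next
    case (Suc r)
    \<comment> \<open>Left bracketing makes this an equality of objects, so consecutive stages
      compose without an associator.\<close>
    have "pad_obj Y (B r) (Suc r) t = pad_obj Y (B r \<odot> Y (Suc r)) (Suc (Suc r)) t"
      using that Suc by (simp add: pad_obj_def upt_conv_Cons del: upt_Suc)
    then show ?thesis
      using pad_right_hom[OF v[of r], of t Y s] Y that Suc by (simp add: Q_def)
  qed
  have eq: "comp_seq C (\<lambda>s. pad_right C Y (v s) s (Suc t)) r
    = comp_seq C (\<lambda>s. pad_right C Y (v s) s t \<otimes> \<one> (Y (Suc t))) r" if "r \<le> t" for r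
    using that by (induction r) (simp_all add: pad_right_Suc)
  show ?thesis
    using comp_seq_tensor[of t "\<lambda>s. pad_right C Y (v s) s t" Q "Y (Suc t)"] Q Y eq[of t]
    by (simp add: iterated_update_def pad_right_def)
qed

end

context markov_category
begin

lemma tens_trunc_hom:
  assumes "\<And>i. i \<le> m \<Longrightarrow> F i \<in> Obj C" "t \<le> m"
  shows "\<guillemotleft>tens_trunc C F t m : tens_obj C F m \<rightarrow> tens_obj C F t\<guillemotright>"
  using assms(2,1)
proof (induction m)
  case (Suc m)
  show ?case
  proof (cases "t = Suc m")
    case False
    then have "\<guillemotleft>tens_trunc C F t m : tens_obj C F m \<rightarrow> tens_obj C F t\<guillemotright>"
      using Suc by simp
    then show ?thesis
      using False Suc.prems by (simp add: in_hom_def)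
  qed (use Suc.prems in \<open>simp add: in_hom_def\<close>)
qed (simp add: in_hom_def)

end

section \<open>Hidden Markov models\<close>

locale hidden_markov_model = markov_category +
  fixes X Y f g n
  assumes kernels: "hmm_kernels C X Y f g n"
begin

abbreviation "joint_kernel t \<equiv> (\<one> (X t) \<otimes> g t) \<cdot> \<Delta> (X t)"
abbreviation "forget_hidden t \<equiv> tens_mor C (\<lambda>s. proj_right C (X s) (Y s)) t"
abbreviation "Ys t \<equiv> tens_obj C Y t"

text \<open>Here the model itself stops at time \<open>t\<close>, which suits recursion on
  \<open>t\<close>; \<open>marg_obs_eq\<close> and \<open>marg_obs_hidden_eq\<close> identify
  \<open>obs\<close> and \<open>hidden_obs\<close> with the marginals of the full model.\<close>

definition "obs t = forget_hidden t \<cdot> hmm_state C X f g t"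
definition "hidden_obs t = pull_hidden C X Y t \<cdot> hmm_state C X f g t"

lemma kernel_simps [simp]:
  assumes "t \<le> n"
  shows "X t \<in> Obj C" "Y t \<in> Obj C" "f t \<in> Arr C" "Dom C (f t) = prev_obj C X t" "Cod C (f t) = X t"
    "g t \<in> Arr C" "Dom C (g t) = X t" "Cod C (g t) = Y t"
  using kernels assms by (auto simp: hmm_kernels_def in_hom_def)

lemma prev_obj_simps [simp]: "prev_obj C X 0 = \<I>" "prev_obj C X (Suc t) = X t"
  by (simp_all add: prev_obj_def)

section \<open>The hidden chain, its observations and their truncations\<close>

lemma hidden_chain_hom:
  "t \<le> n \<Longrightarrow> \<guillemotleft>hidden_chain C X f t : \<I> \<rightarrow> tens_obj C X t\<guillemotright>"
proof (induction t rule: induct_nat_012)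
  case 0
  then show ?case
    by (simp add: in_hom_def)
next
  case 1
  then show ?case
    by (simp add: in_hom_def)
next
  case (ge2 t)
  have [simp]: "tens_obj C X t \<in> Obj C" "X t \<in> Obj C"
    using ge2.prems by auto
  show ?case
    using ge2 by (simp add: in_hom_def)
qed

lemma hidden_chain_simps [simp]:
  assumes "t \<le> n"
  shows "hidden_chain C X f t \<in> Arr C" "Dom C (hidden_chain C X f t) = \<I>"
    "Cod C (hidden_chain C X f t) = tens_obj C X t"
  using hidden_chain_hom[OF assms] by (auto simp: in_hom_def)

text \<open>Deleting the newest state deletes the kernel that made it, and counitality then removes
  the copy of its predecessor.\<close>

lemma hidden_chain_trunc:
  assumes "Suc t \<le> n"
  shows "proj_left C (tens_obj C X t) (X (Suc t)) \<cdot> hidden_chain C X f (Suc t)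
      = hidden_chain C X f t"
proof (cases t)
  case 0
  then show ?thesis
    using assms by (simp add: proj_left_nat_comp)
next
  case (Suc s)
  have [simp]: "tens_obj C X s \<in> Obj C" "Suc s \<le> n" "Suc (Suc s) \<le> n"
    using assms Suc by auto
  let ?A = "tens_obj C X s" and ?B = "X (Suc s)" and ?D = "X (Suc (Suc s))"
  let ?k = "(\<one> ?B \<otimes> f (Suc (Suc s))) \<cdot> \<Delta> ?B"
  have "proj_left C (tens_obj C X t) (X (Suc t)) \<cdot> hidden_chain C X f (Suc t)
    = (proj_left C (?A \<odot> ?B) ?D \<cdot> \<alpha>_inv ?A ?B ?D) \<cdot> (\<one> ?A \<otimes> ?k) \<cdot> hidden_chain C X f (Suc s)"
    using Suc by simp
  also have "\<dots> = (\<one> ?A \<otimes> (proj_left C ?B ?D \<cdot> ?k)) \<cdot> hidden_chain C X f (Suc s)"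
    by (subst proj_left_assoc_inv) auto
  also have "\<dots> = hidden_chain C X f t"
    using Suc by (simp add: proj_left_nat_comp)
  finally show ?thesis .
qed

lemma joint_kernels_simps [simp]:
  assumes "t \<le> n"
  shows "tens_mor C joint_kernel t \<in> Arr C" "Dom C (tens_mor C joint_kernel t) = tens_obj C X t"
    "Cod C (tens_mor C joint_kernel t) = tens_obj C (\<lambda>s. X s \<odot> Y s) t"
  using tens_mor_hom[of t joint_kernel X "\<lambda>s. X s \<odot> Y s"] assms by (auto simp: in_hom_def)

lemma forget_hidden_simps [simp]:
  assumes "t \<le> n"
  shows "forget_hidden t \<in> Arr C" "Dom C (forget_hidden t) = tens_obj C (\<lambda>s. X s \<odot> Y s) t"
    "Cod C (forget_hidden t) = Ys t"
  using tens_mor_hom[of t "\<lambda>s. proj_right C (X s) (Y s)" "\<lambda>s. X s \<odot> Y s" Y] assms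
  by (auto simp: in_hom_def)

lemma obs_kernels_simps [simp]:
  assumes "t \<le> n"
  shows "tens_mor C g t \<in> Arr C" "Dom C (tens_mor C g t) = tens_obj C X t"
    "Cod C (tens_mor C g t) = Ys t"
  using tens_mor_hom[of t g X Y] assms by (auto simp: in_hom_def)

lemma forget_joint_kernels:
  assumes "t \<le> n"
  shows "forget_hidden t \<cdot> tens_mor C joint_kernel t = tens_mor C g t"
proof -
  have "forget_hidden t \<cdot> tens_mor C joint_kernel t
    = tens_mor C (\<lambda>s. proj_right C (X s) (Y s) \<cdot> joint_kernel s) t"
    using assms by (subst tens_mor_comp) auto
  also have "\<dots> = tens_mor C g t"
    using assms by (induction t) (simp_all add: proj_right_nat_comp)
  finally show ?thesis .
qed

lemma hmm_state_simps [simp]: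
  assumes "t \<le> n"
  shows "hmm_state C X f g t \<in> Arr C" "Dom C (hmm_state C X f g t) = \<I>"
    "Cod C (hmm_state C X f g t) = tens_obj C (\<lambda>s. X s \<odot> Y s) t"
  using assms by (simp_all add: hmm_state_def)

text \<open>Causality: later states and observations can be discarded one time step at a time, since
  projections commute with the joint kernels and truncate the chain.\<close>

lemma hmm_state_trunc:
  assumes "t \<le> m" "m \<le> n"
  shows "tens_trunc C (\<lambda>s. X s \<odot> Y s) t m \<cdot> hmm_state C X f g m = hmm_state C X f g t"
  using assms
proof (induction m rule: dec_induct)
  case base
  then show ?case
    by (cases t) simp_all
next
  case (step m)
  have [simp]: "tens_obj C X m \<in> Obj C" "tens_obj C (\<lambda>s. X s \<odot> Y s) m \<in> Obj C" "m \<le> n"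
    using step.prems by auto
  let ?F = "\<lambda>s. X s \<odot> Y s"
  note [simp] = in_homD(1-3)[OF tens_trunc_hom[of m ?F t]]
  have "proj_left C (tens_obj C ?F m) (?F (Suc m)) \<cdot> hmm_state C X f g (Suc m)
    = tens_mor C joint_kernel m \<cdot> proj_left C (tens_obj C X m) (X (Suc m))
        \<cdot> hidden_chain C X f (Suc m)"
    using step.prems by (simp add: hmm_state_def proj_left_nat_comp del: hidden_chain.simps)
  also have "\<dots> = hmm_state C X f g m"
    using step.prems by (simp add: hidden_chain_trunc hmm_state_def del: hidden_chain.simps)
  finally show ?case
    using step by simp
qed

lemma marg_obs_eq: "t \<le> n \<Longrightarrow> marg_obs C X Y n (hmm_state C X f g n) t = obs t"
  by (simp add: marg_obs_def obs_def hmm_state_trunc)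

lemma marg_obs_hidden_eq:
  "t \<le> n \<Longrightarrow> marg_obs_hidden C X Y n (hmm_state C X f g n) t = hidden_obs t"
  by (simp add: marg_obs_hidden_def hidden_obs_def hmm_state_trunc)

section \<open>The joint law of the observations and the current hidden state\<close>

lemma pull_hidden_simps [simp]:
  assumes "t \<le> n"
  shows "pull_hidden C X Y t \<in> Arr C" "Dom C (pull_hidden C X Y t) = tens_obj C (\<lambda>s. X s \<odot> Y s) t"
    "Cod C (pull_hidden C X Y t) = X t \<odot> Ys t"
  using assms by (auto simp: pull_hidden_def split: nat.split)

lemma obs_simps [simp]:
  assumes "t \<le> n"
  shows "obs t \<in> Arr C" "Dom C (obs t) = \<I>" "Cod C (obs t) = Ys t"
    "hidden_obs t \<in> Arr C" "Dom C (hidden_obs t) = \<I>" "Cod C (hidden_obs t) = X t \<odot> Ys t"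
  using assms by (simp_all add: obs_def hidden_obs_def)

lemma proj_right_hidden_obs:
  assumes "t \<le> n"
  shows "proj_right C (X t) (Ys t) \<cdot> hidden_obs t = obs t"
proof -
  have "proj_right C (X t) (Ys t) \<cdot> pull_hidden C X Y t = forget_hidden t"
  proof (cases t)
    case 0
    then show ?thesis
      using assms by (simp add: pull_hidden_def)
  next
    case (Suc s)
    have [simp]: "Ys s \<in> Obj C" "s \<le> n" "Suc s \<le> n"
      using assms Suc by auto
    let ?Z = "Ys s" and ?X = "X (Suc s)" and ?Y = "Y (Suc s)"
    have "proj_right C (X t) (Ys t) \<cdot> pull_hidden C X Y t
      = (proj_right C ?X (?Z \<odot> ?Y) \<cdot> \<alpha> ?X ?Z ?Y \<cdot> (\<sigma> ?Z ?X \<otimes> \<one> ?Y) \<cdot> \<alpha>_inv ?Z ?X ?Y)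
        \<cdot> (forget_hidden s \<otimes> \<one> (?X \<odot> ?Y))"
      using Suc by (simp add: pull_hidden_def)
    also have "\<dots> = forget_hidden t"
      by (subst proj_right_swap) (use Suc in auto)
    finally show ?thesis .
  qed
  then show ?thesis
    using assms by (simp add: obs_def hidden_obs_def assoc_comp[symmetric] del: assoc_comp)
qed

text \<open>The Markov property: the past enters the new law only through
  \<open>hidden_obs t\<close>, whose component \<open>X t\<close> is fed into the next transition
  and observation.\<close>

lemma hidden_obs_Suc:
  assumes t: "Suc t \<le> n"
  shows "hidden_obs (Suc t) = \<alpha> (X (Suc t)) (Ys t) (Y (Suc t))
      \<cdot> (\<sigma> (Ys t) (X (Suc t)) \<otimes> \<one> (Y (Suc t)))
    \<cdot> \<alpha>_inv (Ys t) (X (Suc t)) (Y (Suc t)) \<cdot> (\<one> (Ys t) \<otimes> (joint_kernel (Suc t) \<cdot> f (Suc t)))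
    \<cdot> \<sigma> (X t) (Ys t) \<cdot> hidden_obs t"
proof -
  have [simp]: "Ys t \<in> Obj C" "tens_obj C X t \<in> Obj C" "t \<le> n"
    using t by auto
  let ?Y = "Y (Suc t)" and ?X = "X (Suc t)"
  let ?k = "joint_kernel (Suc t) \<cdot> f (Suc t)"
  \<comment> \<open>The common reordering prefix is left out here and restored at the end.\<close>
  have "(tens_mor C g t \<otimes> joint_kernel (Suc t)) \<cdot> hidden_chain C X f (Suc t)
    = (\<one> (Ys t) \<otimes> ?k) \<cdot> \<sigma> (X t) (Ys t) \<cdot> hidden_obs t"
  proof (cases t)
    case 0
    \<comment> \<open>At time 0 \<open>pull_hidden\<close> is an identity, and only the order of the
      two copies of \<open>X 0\<close> has to be exchanged.\<close>
    have "(\<one> (Y 0) \<otimes> ?k) \<cdot> \<sigma> (X 0) (Y 0) \<cdot> hidden_obs 0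
      = (\<one> (Y 0) \<otimes> ?k) \<cdot> (\<sigma> (X 0) (Y 0) \<cdot> (\<one> (X 0) \<otimes> g 0)) \<cdot> \<Delta> (X 0) \<cdot> f 0"
      using t 0 by (simp add: hidden_obs_def pull_hidden_def hmm_state_def)
    also have "\<dots> = (g 0 \<otimes> ?k) \<cdot> (\<sigma> (X 0) (X 0) \<cdot> \<Delta> (X 0)) \<cdot> f 0"
      using t 0 by (simp add: swap_nat)
    also have "\<dots> = (g 0 \<otimes> ?k) \<cdot> \<Delta> (X 0) \<cdot> f 0"
      by (subst copy_comm) auto
    finally show ?thesis
      using t 0 by simp
  next
    case (Suc s)
    have [simp]: "Ys s \<in> Obj C" "tens_obj C X s \<in> Obj C" "s \<le> n" "Suc s \<le> n" "Suc (Suc s) \<le> n"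
      using t Suc by auto
    let ?A = "tens_obj C X s" and ?Z = "Ys s" and ?B = "X (Suc s)" and ?D = "Y (Suc s)"
    let ?G = "tens_mor C g s" and ?m = "hidden_chain C X f (Suc s)"
    let ?W = "X (Suc (Suc s)) \<odot> Y (Suc (Suc s))"
    \<comment> \<open>Both sides are brought to one normal form, in which a single copy of the
      current state feeds its observation \<open>g\<close> and the next step
      \<open>?k\<close>.\<close>
    have "(tens_mor C g t \<otimes> joint_kernel (Suc t)) \<cdot> hidden_chain C X f (Suc t)
      = ((?G \<otimes> g (Suc s) \<otimes> joint_kernel (Suc t)) \<cdot> \<alpha>_inv ?A ?B ?X)
        \<cdot> (\<one> ?A \<otimes> ((\<one> ?B \<otimes> f (Suc t)) \<cdot> \<Delta> ?B)) \<cdot> ?m"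
      using Suc by simp
    also have "(?G \<otimes> g (Suc s) \<otimes> joint_kernel (Suc t)) \<cdot> \<alpha>_inv ?A ?B ?X
      = \<alpha>_inv ?Z ?D ?W \<cdot> (?G \<otimes> (g (Suc s) \<otimes> joint_kernel (Suc t)))"
      using Suc by (subst assoc_inv_nat) auto
    also have "(\<alpha>_inv ?Z ?D ?W \<cdot> (?G \<otimes> (g (Suc s) \<otimes> joint_kernel (Suc t))))
        \<cdot> (\<one> ?A \<otimes> ((\<one> ?B \<otimes> f (Suc t)) \<cdot> \<Delta> ?B)) \<cdot> ?m
      = \<alpha>_inv ?Z ?D ?W \<cdot> (?G \<otimes> ((g (Suc s) \<otimes> ?k) \<cdot> \<Delta> ?B)) \<cdot> ?m"
      using Suc by simp
    finally have lhs: "(tens_mor C g t \<otimes> joint_kernel (Suc t)) \<cdot> hidden_chain C X f (Suc t)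
      = \<alpha>_inv ?Z ?D ?W \<cdot> (?G \<otimes> ((g (Suc s) \<otimes> ?k) \<cdot> \<Delta> ?B)) \<cdot> ?m" .
    have "(\<one> (Ys t) \<otimes> ?k) \<cdot> \<sigma> (X t) (Ys t) \<cdot> hidden_obs t
      = (\<one> (?Z \<odot> ?D) \<otimes> ?k)
        \<cdot> (\<sigma> ?B (?Z \<odot> ?D) \<cdot> \<alpha> ?B ?Z ?D \<cdot> (\<sigma> ?Z ?B \<otimes> \<one> ?D) \<cdot> \<alpha>_inv ?Z ?B ?D)
        \<cdot> ((forget_hidden s \<cdot> tens_mor C joint_kernel s) \<otimes> joint_kernel (Suc s)) \<cdot> ?m"
      using Suc by (simp add: hidden_obs_def pull_hidden_def hmm_state_def)
    \<comment> \<open>\<open>swap_tensor'\<close> leaves only the swap of the current state with its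
      observation, which naturality and \<open>copy_comm\<close> absorb below.\<close>
    also have "\<dots> = ((\<one> ?Z \<otimes> \<one> ?D \<otimes> ?k) \<cdot> \<alpha>_inv ?Z ?D ?B) \<cdot> (\<one> ?Z \<otimes> \<sigma> ?B ?D)
        \<cdot> (?G \<otimes> joint_kernel (Suc s)) \<cdot> ?m"
      using Suc by (subst swap_tensor', simp_all add: forget_joint_kernels)
    also have "(\<one> ?Z \<otimes> \<one> ?D \<otimes> ?k) \<cdot> \<alpha>_inv ?Z ?D ?B = \<alpha>_inv ?Z ?D ?W \<cdot> (\<one> ?Z \<otimes> (\<one> ?D \<otimes> ?k))"
      using Suc by (subst assoc_inv_nat) auto
    also have "(\<alpha>_inv ?Z ?D ?W \<cdot> (\<one> ?Z \<otimes> (\<one> ?D \<otimes> ?k))) \<cdot> (\<one> ?Z \<otimes> \<sigma> ?B ?D)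
        \<cdot> (?G \<otimes> joint_kernel (Suc s)) \<cdot> ?m
      = \<alpha>_inv ?Z ?D ?W \<cdot> (?G \<otimes> ((\<one> ?D \<otimes> ?k) \<cdot> (\<sigma> ?B ?D \<cdot> (\<one> ?B \<otimes> g (Suc s))) \<cdot> \<Delta> ?B)) \<cdot> ?m"
      using Suc by simp
    also have "\<dots> = \<alpha>_inv ?Z ?D ?W \<cdot> (?G \<otimes> ((g (Suc s) \<otimes> ?k) \<cdot> (\<sigma> ?B ?B \<cdot> \<Delta> ?B))) \<cdot> ?m"
      using Suc by (simp add: swap_nat)
    also have "\<dots> = \<alpha>_inv ?Z ?D ?W \<cdot> (?G \<otimes> ((g (Suc s) \<otimes> ?k) \<cdot> \<Delta> ?B)) \<cdot> ?m"
      by (subst copy_comm) auto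
    finally show ?thesis
      unfolding lhs by simp
  qed
  moreover have "hidden_obs (Suc t) = \<alpha> ?X (Ys t) ?Y \<cdot> (\<sigma> (Ys t) ?X \<otimes> \<one> ?Y) \<cdot> \<alpha>_inv (Ys t) ?X ?Y
    \<cdot> ((forget_hidden t \<cdot> tens_mor C joint_kernel t) \<otimes> joint_kernel (Suc t))
        \<cdot> hidden_chain C X f (Suc t)"
    using t by (simp add: hidden_obs_def pull_hidden_def hmm_state_def del: hidden_chain.simps)
  ultimately show ?thesis
    using t by (simp add: forget_joint_kernels del: hidden_chain.simps interchange interchange_comp)
qed

section \<open>Recursion for the Bayes filter\<close>

lemma bayes_filter_state:
  assumes "t \<le> n" "is_bayes_filter C X Y n (hmm_state C X f g n) t b"
  shows "hidden_obs t = (b \<otimes> \<one> (Ys t)) \<cdot> \<Delta> (Ys t) \<cdot> obs t"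
  using assms conditional_of_state[of "X t" "Ys t" "hidden_obs t" b]
  by (auto simp: is_bayes_filter_def marg_obs_hidden_eq proj_right_hidden_obs)

text \<open>The inductive step, with \<open>k\<close> standing for \<open>samp\<close> and
  \<open>w\<close> for the iterated update. In \<open>hidden_obs t\<close> the filter
  \<open>b\<close> acts on a copy drawn from \<open>obs t\<close>, so \<open>k \<cdot> w\<close> may
  replace it; \<open>conditional_precomp\<close> and \<open>filter_step\<close> then give the
  disintegration at the next time.\<close>

lemma filter_recursion:
  assumes t: "Suc t \<le> n"
    and b: "hidden_obs t = (b \<otimes> \<one> (Ys t)) \<cdot> \<Delta> (Ys t) \<cdot> obs t"
    and eq: "as_eq C (obs t) b (k \<cdot> w)"
    and w: "\<guillemotleft>w : Ys t \<rightarrow> A\<guillemotright>" "deterministic C w" and k: "\<guillemotleft>k : A \<rightarrow> X t\<guillemotright>"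
    and v: "is_conditional C A (X (Suc t)) (Y (Suc t)) (joint_kernel (Suc t) \<cdot> f (Suc t) \<cdot> k) v"
  shows "hidden_obs (Suc t) = ((v \<cdot> (w \<otimes> \<one> (Y (Suc t)))) \<otimes> \<one> (Ys (Suc t))) \<cdot> \<Delta> (Ys (Suc t))
      \<cdot> obs (Suc t)"
proof -
  have [simp]: "t \<le> n" "Ys t \<in> Obj C"
    using t by auto
  let ?Z = "Ys t" and ?X = "X (Suc t)" and ?Y = "Y (Suc t)"
  let ?c = "joint_kernel (Suc t) \<cdot> f (Suc t) \<cdot> k \<cdot> w" and ?v = "v \<cdot> (w \<otimes> \<one> ?Y)"
  let ?h = "proj_right C ?X ?Y \<cdot> ?c"
  note [simp] = in_homD[OF w(1)] in_homD[OF k]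
  have bt: "\<guillemotleft>b : ?Z \<rightarrow> X t\<guillemotright>"
    using eq t by (auto simp: as_eq_def in_hom_def)
  note [simp] = in_homD(1-3)[OF bt]
  have vt: "\<guillemotleft>?v : ?Z \<odot> ?Y \<rightarrow> ?X\<guillemotright>" and ht: "\<guillemotleft>?h : ?Z \<rightarrow> ?Y\<guillemotright>"
    using v t by (auto simp: is_conditional_def in_hom_def)
  have c: "?c = (?v \<otimes> \<one> ?Y) \<cdot> \<alpha>_inv ?Z ?Y ?Y \<cdot> (\<one> ?Z \<otimes> \<Delta> ?Y) \<cdot> (\<one> ?Z \<otimes> ?h) \<cdot> \<Delta> ?Z"
    using conditional_precomp[OF v w] t by (simp add: is_conditional_def)
  \<comment> \<open>The swap brings \<open>b\<close> to the second copy, the shape in which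
    \<open>as_eq\<close> applies.\<close>
  have "\<sigma> (X t) ?Z \<cdot> hidden_obs t = (\<one> ?Z \<otimes> b) \<cdot> (\<sigma> ?Z ?Z \<cdot> \<Delta> ?Z) \<cdot> obs t"
    using t by (simp add: b swap_nat_comp)
  also have "\<dots> = (\<one> ?Z \<otimes> (k \<cdot> w)) \<cdot> \<Delta> ?Z \<cdot> obs t"
    using as_eqD[OF eq] by (simp add: copy_comm)
  finally have "hidden_obs (Suc t)
      = (\<alpha> ?X ?Z ?Y \<cdot> (\<sigma> ?Z ?X \<otimes> \<one> ?Y) \<cdot> \<alpha>_inv ?Z ?X ?Y \<cdot> (\<one> ?Z \<otimes> ?c) \<cdot> \<Delta> ?Z) \<cdot> obs t"
    using t by (simp add: hidden_obs_Suc)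
  also have "\<dots> = ((?v \<otimes> \<one> (?Z \<odot> ?Y)) \<cdot> \<Delta> (?Z \<odot> ?Y) \<cdot> (\<one> ?Z \<otimes> ?h) \<cdot> \<Delta> ?Z) \<cdot> obs t"
    by (subst c, subst filter_step[OF vt ht]) (rule refl)
  also have "\<dots> = (?v \<otimes> \<one> (?Z \<odot> ?Y)) \<cdot> \<Delta> (?Z \<odot> ?Y) \<cdot> (\<one> ?Z \<otimes> ?h) \<cdot> \<Delta> ?Z \<cdot> obs t"
    using in_homD[OF vt] in_homD[OF ht] by (simp del: interchange interchange_comp)
  finally have j: "hidden_obs (Suc t)
      = (?v \<otimes> \<one> (?Z \<odot> ?Y)) \<cdot> \<Delta> (?Z \<odot> ?Y) \<cdot> (\<one> ?Z \<otimes> ?h) \<cdot> \<Delta> ?Z \<cdot> obs t" .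
  \<comment> \<open>Deleting the hidden state on both sides of \<open>j\<close> identifies the law
    being copied there as \<open>obs (Suc t)\<close>.\<close>
  have "obs (Suc t) = proj_right C ?X (Ys (Suc t)) \<cdot> hidden_obs (Suc t)"
    unfolding proj_right_hidden_obs[OF t] ..
  also have "\<dots> = (\<one> ?Z \<otimes> ?h) \<cdot> \<Delta> ?Z \<cdot> obs t"
    unfolding j using in_homD[OF vt] in_homD[OF ht] t
    by (simp add: proj_right_nat_comp del: interchange interchange_comp)
  finally show ?thesis
    using j by simp
qed

end

text \<open>Unique existence justifies the definite description. The last claim is the uniqueness
  half, by which a deterministic morphism is recognised as the counterpart of its composite with
  \<open>samp\<close>.\<close>

lemma det_counterpart_props:
  fixes C (structure)
  assumes "is_representation C P samp" "\<guillemotleft>f : A \<rightarrow> B\<guillemotright>" "B \<in> Obj C"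
  shows "\<guillemotleft>det_counterpart C P samp f : A \<rightarrow> P B\<guillemotright>" "deterministic C (det_counterpart C P samp f)"
    "samp B \<cdot> det_counterpart C P samp f = f"
    "\<lbrakk>\<guillemotleft>h : A \<rightarrow> P B\<guillemotright>; deterministic C h; f = samp B \<cdot> h\<rbrakk> \<Longrightarrow> det_counterpart C P samp f = h"
proof -
  have ex: "\<exists>!h. \<guillemotleft>h : A \<rightarrow> P B\<guillemotright> \<and> deterministic C h \<and> f = samp B \<cdot> h"
    using assms unfolding is_representation_def by blast
  have eq: "det_counterpart C P samp f
      = (THE h. \<guillemotleft>h : A \<rightarrow> P B\<guillemotright> \<and> deterministic C h \<and> f = samp B \<cdot> h)"
    using assms(2) by (simp add: det_counterpart_def in_hom_def)
  show "\<guillemotleft>det_counterpart C P samp f : A \<rightarrow> P B\<guillemotright>" "deterministic C (det_counterpart C P samp f)"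
    "samp B \<cdot> det_counterpart C P samp f = f"
    using theI'[OF ex] unfolding eq by simp_all
  show "\<lbrakk>\<guillemotleft>h : A \<rightarrow> P B\<guillemotright>; deterministic C h; f = samp B \<cdot> h\<rbrakk> \<Longrightarrow> det_counterpart C P samp f = h"
    unfolding eq using ex by (intro the1_equality) auto
qed

theorem corollary4p12:
  fixes C :: "('o, 'm, 'z) markov_data_scheme" (structure)
    and P :: "'o \<Rightarrow> 'o" and samp :: "'o \<Rightarrow> 'm"
    and X Y :: "nat \<Rightarrow> 'o" and f g :: "nat \<Rightarrow> 'm" and n :: nat and p :: 'm
    and BF u :: "nat \<Rightarrow> 'm"
  assumes markov: "markov_category C"
    and conditionals: "has_conditionals C"
    and representable: "as_compatible_representation C P samp"
    and kernels: "hmm_kernels C X Y f g n"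
    and state: "p = hmm_state C X f g n"
    and bayes_filter: "\<And>t. t \<le> n \<Longrightarrow> is_bayes_filter C X Y n p t (BF t)"
    and update_0: "u 0 = BF 0"
    and update: "\<And>t. \<lbrakk>0 < t; t \<le> n\<rbrakk>
          \<Longrightarrow> is_update_map C P samp (X (t - 1)) (X t) (Y t) (f t) (g t) (u t)"
  shows "\<forall>t\<le>n.
      as_eq C (marg_obs C X Y n p t)
        (det_counterpart C P samp (BF t))
        (iterated_update C Y (\<lambda>s. det_counterpart C P samp (u s)) t)
    \<and> as_eq C (marg_obs C X Y n p t)
        (samp (X t) \<cdot> iterated_update C Y (\<lambda>s. det_counterpart C P samp (u s)) t)
        (BF t)"
proof -
  interpret hidden_markov_model C X Y f g n
    using markov kernels by (simp add: hidden_markov_model_def hidden_markov_model_axioms_def)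
  let ?v = "\<lambda>s. det_counterpart C P samp (u s)"
  let ?w = "iterated_update C Y ?v"
  have rep: "is_representation C P samp"
    and compat: "\<And>q a b. as_eq C q a b
        \<Longrightarrow> as_eq C q (det_counterpart C P samp a) (det_counterpart C P samp b)"
    using representable by (auto simp: as_compatible_representation_def)
  have samp: "\<guillemotleft>samp (X t) : P (X t) \<rightarrow> X t\<guillemotright>" if "t \<le> n" for t
    using rep that by (simp add: is_representation_def)
  have BF: "\<guillemotleft>BF t : Ys t \<rightarrow> X t\<guillemotright>"
    "hidden_obs t = (BF t \<otimes> \<one> (Ys t)) \<cdot> \<Delta> (Ys t) \<cdot> obs t" if "t \<le> n" for t
    using bayes_filter[OF that] bayes_filter_state[OF that] state
    by (auto simp: is_bayes_filter_def)
  have u: "\<guillemotleft>u (Suc t) : P (X t) \<odot> Y (Suc t) \<rightarrow> X (Suc t)\<guillemotright>"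
    "is_conditional C (P (X t)) (X (Suc t)) (Y (Suc t)) (joint_kernel (Suc t) \<cdot> f (Suc t)
        \<cdot> samp (X t)) (u (Suc t))"
    if "Suc t \<le> n" for t
    using update[of "Suc t"] that in_homD[OF samp[of t]]
    by (auto simp: is_update_map_def is_conditional_def simp del: interchange interchange_comp)
  \<comment> \<open>\<open>u 0\<close> is the filter itself, with domain \<open>Y 0\<close> instead
    of a product with a previous state, so time 0 is kept apart.\<close>
  note v_0 = det_counterpart_props[OF rep BF(1)[of 0, folded update_0]]
  note v_Suc = det_counterpart_props[OF rep u(1)]
  have w_Suc: "?w (Suc t) = ?v (Suc t) \<cdot> (?w t \<otimes> \<one> (Y (Suc t)))" if "Suc t \<le> n" for t
    using v_0(1) v_Suc(1) that by (intro iterated_update_Suc[where B = "\<lambda>s. P (X s)"]) auto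
  \<comment> \<open>Determinism is carried through the induction because
    \<open>filter_recursion\<close> requires it of \<open>w\<close>.\<close>
  have main: "\<guillemotleft>?w t : Ys t \<rightarrow> P (X t)\<guillemotright> \<and> deterministic C (?w t)
      \<and> as_eq C (obs t) (BF t) (samp (X t) \<cdot> ?w t)"
    if "t \<le> n" for t
    using that
  proof (induction t)
    case 0
    have "?w 0 = ?v 0"
      by (simp add: iterated_update_def pad_right_def)
    \<comment> \<open>Reflexivity is enough: \<open>samp (X 0) \<cdot> ?w 0\<close> equals
      \<open>u 0 = BF 0\<close> exactly.\<close>
    moreover have "as_eq C (obs 0) (BF 0) (BF 0)"
      by (rule as_eqI[OF _ BF(1) BF(1)]) auto
    ultimately show ?case
      using v_0(1-3) update_0 by simp
  next
    case (Suc t)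
    then have w: "\<guillemotleft>?w t : Ys t \<rightarrow> P (X t)\<guillemotright>" "deterministic C (?w t)"
      "as_eq C (obs t) (BF t) (samp (X t) \<cdot> ?w t)" and t: "t \<le> n"
      by auto
    note v = v_Suc[OF Suc.prems]
    have Y: "Y (Suc t) \<in> Obj C" "X (Suc t) \<in> Obj C"
      using Suc.prems by auto
    have hom: "\<guillemotleft>?w (Suc t) : Ys (Suc t) \<rightarrow> P (X (Suc t))\<guillemotright>"
      using w(1) v(1)[OF Y(2)] ident_hom[OF Y(1)]
      by (auto simp: w_Suc[OF Suc.prems] intro: comp_hom tensor_hom)
    have det: "deterministic C (?w (Suc t))"
      using w v(1,2)[OF Y(2)] Y
      by (auto simp: w_Suc[OF Suc.prems] in_hom_def
            intro!: deterministic_comp deterministic_tensor deterministic_ident)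
    \<comment> \<open>Sampling undoes only the outermost counterpart, which exposes the conditional
      \<open>u (Suc t)\<close>.\<close>
    have samp_w: "samp (X (Suc t)) \<cdot> ?w (Suc t) = u (Suc t) \<cdot> (?w t \<otimes> \<one> (Y (Suc t)))"
    proof -
      have "samp (X (Suc t)) \<cdot> ?w (Suc t)
          = (samp (X (Suc t)) \<cdot> ?v (Suc t)) \<cdot> (?w t \<otimes> \<one> (Y (Suc t)))"
        using w(1) v(1)[OF Y(2)] samp[OF Suc.prems] Y by (simp add: w_Suc[OF Suc.prems] in_hom_def)
      then show ?thesis
        using v(3)[OF Y(2)] by simp
    qed
    have "hidden_obs (Suc t) = ((samp (X (Suc t)) \<cdot> ?w (Suc t)) \<otimes> \<one> (Ys (Suc t))) \<cdot> \<Delta> (Ys (Suc t))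
        \<cdot> obs (Suc t)"
      unfolding samp_w
      by (rule filter_recursion[OF Suc.prems BF(2)[OF t] w(3,1,2) samp[OF t] u(2)[OF Suc.prems]])
    \<comment> \<open>\<open>BF (Suc t)\<close> satisfies the same disintegration of
      \<open>hidden_obs (Suc t)\<close>, which is the equation required by
      \<open>as_eqI\<close>.\<close>
    then have "as_eq C (obs (Suc t)) (BF (Suc t)) (samp (X (Suc t)) \<cdot> ?w (Suc t))"
      using BF[OF Suc.prems] Suc.prems
      by (intro as_eqI[OF _ BF(1)[OF Suc.prems] comp_hom[OF hom samp[OF Suc.prems]]]) auto
    then show ?case
      using hom det by blast
  qed
  show ?thesis
  proof (intro allI impI)
    fix t assume t: "t \<le> n"
    \<comment> \<open>By uniqueness; a.s.-compatibility then transfers \<open>main\<close> to the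
      deterministic counterparts.\<close>
    have "det_counterpart C P samp (samp (X t) \<cdot> ?w t) = ?w t"
      using main[OF t] t comp_hom[OF _ samp[OF t]]
      by (intro det_counterpart_props(4)[OF rep]) auto
    then show "as_eq C (marg_obs C X Y n p t) (det_counterpart C P samp (BF t)) (?w t)
      \<and> as_eq C (marg_obs C X Y n p t) (samp (X t) \<cdot> ?w t) (BF t)"
      using main[OF t] compat[of "obs t" "BF t" "samp (X t) \<cdot> ?w t"] as_eq_sym
      by (simp add: state marg_obs_eq[OF t])
  qed
qed

end
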